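(* Let $\mathcal{D}$ be a distribution on $\mathcal{X}$, $X\sim\mathcal{D}^n$, $k\ge1$, $\rho>0$. Consider $k$ rounds in which an arbitrary (possibly randomized) analyst chooses statistical queries $\phi_i:\mathcal{X}\to[0,1]$ as functions of previous answers $a_1,\dots,a_{i-1}$, and the Gaussian mechanism answers $a_i=\phi_i(X)+Z_i$ with $Z_1,\dots,Z_k$ i.i.d. $N\!\left(0,\frac{1}{2n^2\rho}\right)$. Then $$\mathbb{E}\left[\max_{i\in[k]}(\phi_i(\mathcal{D})-a_i)^2\right]\le\frac{1}{2n}\inf_{\lambda\in(0,1)}\left(\frac{2\rho kn-\ln(1-\lambda)}{\lambda}\right)+2\,\mathbb{E}_{Z_i\sim N(0,\frac{1}{2n^2\rho})\text{ i.i.d.}}\left[\max_{i\in[k]}Z_i^2\right].$$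
   Context: For a statistical query $\phi$, $\phi(X)=\frac1n\sum_j\phi(x_j)$ and $\phi(\mathcal{D})=\mathbb{E}_{x\sim\mathcal{D}}\phi(x)$. The expectation on the left is over $X$, the mechanism's noise and the analyst's randomness. *)

theory Defs
  imports "HOL-Probability.Probability"
begin

definition emp_mean :: "nat \<Rightarrow> ('x \<Rightarrow> real) \<Rightarrow> (nat \<Rightarrow> 'x) \<Rightarrow> real" where
  "emp_mean n \<phi> xs = (1 / real n) * (\<Sum>j<n. \<phi> (xs j))"

text \<open>Interaction transcript. The analyst is given by Q: in round i (0-based) it chooses the
  query Q i h r, where h holds the previous answers a_0..a_{i-1} (indices < i, undefined
  elsewhere) and r is the analyst's random seed. The Gaussian mechanism answers
  emp_mean + z i. hist i is the vector of the first i answers.\<close>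
primrec hist :: "nat \<Rightarrow> (nat \<Rightarrow> (nat \<Rightarrow> real) \<Rightarrow> 'r \<Rightarrow> 'x \<Rightarrow> real) \<Rightarrow> 'r
    \<Rightarrow> (nat \<Rightarrow> 'x) \<Rightarrow> (nat \<Rightarrow> real) \<Rightarrow> nat \<Rightarrow> (nat \<Rightarrow> real)" where
  "hist n Q r xs z 0 = (\<lambda>_. undefined)"
| "hist n Q r xs z (Suc i) =
     (hist n Q r xs z i)(i := emp_mean n (Q i (hist n Q r xs z i) r) xs + z i)"

definition answer :: "nat \<Rightarrow> (nat \<Rightarrow> (nat \<Rightarrow> real) \<Rightarrow> 'r \<Rightarrow> 'x \<Rightarrow> real) \<Rightarrow> 'r
    \<Rightarrow> (nat \<Rightarrow> 'x) \<Rightarrow> (nat \<Rightarrow> real) \<Rightarrow> nat \<Rightarrow> real" where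
  "answer n Q r xs z i = hist n Q r xs z (Suc i) i"

definition query :: "nat \<Rightarrow> (nat \<Rightarrow> (nat \<Rightarrow> real) \<Rightarrow> 'r \<Rightarrow> 'x \<Rightarrow> real) \<Rightarrow> 'r
    \<Rightarrow> (nat \<Rightarrow> 'x) \<Rightarrow> (nat \<Rightarrow> real) \<Rightarrow> nat \<Rightarrow> 'x \<Rightarrow> real" where
  "query n Q r xs z i = Q i (hist n Q r xs z i) r"

end

theory Submission
  imports Defs
begin

text \<open>
  The round in which the answer is farthest from the population mean is a function of the
  transcript alone, so selecting it is post-processing; since
  (phi(D) - a)^2 \<le> 2 (phi(D) - phi(X))^2 + 2 Z^2, it suffices to bound the generalization
  error of this single selected query. For a transcript independent of the sample, Hoeffding's
  lemma and Gaussian linearization give E exp(2 n t (phi(X) - phi(D))^2) \<le> (1 - t)^(-1/2). The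
  dependence is paid for by relative entropy: replacing one sample point moves every mean by at
  most 1/n, hence changes the law of the transcript by at most k rho in relative entropy, and the
  Gibbs variational bound applied to one coordinate at a time adds up to n k rho.
\<close>

text \<open>The obstacle is that the selected query depends on the sample twice, through the
  analyst's adaptivity and through the selection itself, so no concentration inequality applies to
  it directly. Under the product reference measure the transcript is frozen first, and then
  \<open>worst\<close> picks one fixed query: no union bound over the rounds is needed, and the
  exponential moment is free of \<open>k\<close>. The constants balance as follows. With weight 2nt
  on the squared generalization error, the entropy costs n k \<rho> and the logarithm of the
  exponential moment is -ln(1 - t)/2. Dividing by 2nt gives (2 \<rho> k n - ln(1 - t)) / (4nt), and
  the factor 2 from splitting the square leaves the stated bound, with t in the role of \<lambda>.
  The value \<rho> per round is (1/n)^2 / (2 \<sigma>^2), the relative entropy of two Gaussians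
  whose means differ by 1/n.\<close>

section \<open>The Gibbs variational bound\<close>

text \<open>
  The integrand of the relative entropy, normalized to be nonnegative: the correction v - u
  integrates to 0 for probability densities, and every entropy estimate becomes an inequality
  between nonnegative integrals without integrability conditions.
\<close>
definition klint :: "real \<Rightarrow> real \<Rightarrow> real" where
  "klint u v = u * ln (u / v) - u + v"

lemma klint_nonneg: assumes "u > 0" "v > 0" shows "klint u v \<ge> 0"
proof -
  have "ln (v / u) \<le> v / u - 1" using assms by (intro ln_le_minus_one) auto
  then have "u * ln (v / u) \<le> u * (v / u - 1)" using assms by (intro mult_left_mono) auto
  also have "u * (v / u - 1) = v - u" using assms by (simp add: field_simps)
  finally show ?thesis using assms by (simp add: klint_def ln_div algebra_simps)
qed

lemma measurable_klint [measurable (raw)]: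
  assumes [measurable]: "u \<in> borel_measurable M" "v \<in> borel_measurable M"
  shows "(\<lambda>x. klint (u x) (v x)) \<in> borel_measurable M"
  unfolding klint_def by measurable

text \<open>Nonnegativity of \<open>klint\<close> with the second argument tilted to
  \<open>v * exp (s - t)\<close>. This is the pointwise Fenchel-Young inequality behind
  Donsker-Varadhan duality: \<open>s\<close> plays the test function and \<open>t\<close> its
  log-normalization.\<close>

lemma klint_change_of_measure:
  assumes "u > 0" "v > 0"
  shows "u * s + v \<le> u * t + klint u v + v * exp (s - t)"
proof -
  have "0 \<le> klint u (v * exp (s - t))" using assms by (intro klint_nonneg) auto
  then show ?thesis using assms by (simp add: klint_def ln_div ln_mult algebra_simps)
qed

text \<open>The chain rule of relative entropy at the level of integrands. The corrections are
  placed so that every term on either side is nonnegative, which lets the identity be integrated in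
  \<open>ennreal\<close> without subtraction.\<close>

lemma klint_mult:
  assumes "u > 0" "v > 0" "s > 0" "t > 0"
  shows "klint (u * s) (v * t) + v * s + u * t = klint u v * s + u * klint s t + v * t + u * s"
  using assms by (simp add: klint_def ln_div ln_mult algebra_simps)

lemma ennreal_add_right_le_cancel:
  fixes a b c :: ennreal
  assumes "a + c \<le> b + c" "c < top"
  shows "a \<le> b"
  using assms ennreal_add_left_cancel_le[of c a b] by (auto simp: add.commute)

text \<open>Donsker-Varadhan duality, with \<open>D\<close> times the law \<open>p x'\<close> of one
  arbitrary frozen point \<open>x'\<close> as reference measure. Hence entropies between pairs of
  laws suffice. For each frozen \<open>a\<close> the exponential moment is taken over the point
  alone, and its logarithm is averaged under the true law of \<open>a\<close>.\<close>

lemma gibbs_variational_bound: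
  fixes p g :: "'x \<Rightarrow> 'a \<Rightarrow> real" and \<kappa> :: ennreal
  assumes "prob_space D" "sigma_finite_measure M"
    and p_meas [measurable]: "(\<lambda>(x, a). p x a) \<in> borel_measurable (D \<Otimes>\<^sub>M M)"
    and p_pos: "\<And>x a. p x a > 0"
    and p_one: "\<And>x. x \<in> space D \<Longrightarrow> (\<integral>\<^sup>+a. p x a \<partial>M) = 1"
    and kl: "\<And>x x'. x \<in> space D \<Longrightarrow> x' \<in> space D \<Longrightarrow> (\<integral>\<^sup>+a. klint (p x a) (p x' a) \<partial>M) \<le> \<kappa>"
    and g_meas [measurable]: "(\<lambda>(x, a). g x a) \<in> borel_measurable (D \<Otimes>\<^sub>M M)"
    and g_bd: "\<And>x a. 0 \<le> g x a" "\<And>x a. g x a \<le> B"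
  shows "(\<integral>\<^sup>+x. \<integral>\<^sup>+a. ennreal (p x a * g x a) \<partial>M \<partial>D)
     \<le> \<kappa> + (\<integral>\<^sup>+x. \<integral>\<^sup>+a. ennreal (p x a * ln (\<integral>y. exp (g y a) \<partial>D)) \<partial>M \<partial>D)"
proof -
  interpret D: prob_space D by fact
  interpret M: sigma_finite_measure M by fact
  interpret DM: pair_sigma_finite D M ..
  define Z where "Z a = (\<integral>y. exp (g y a) \<partial>D)" for a
  define G where "G a = ln (Z a)" for a
  have Z_meas [measurable]: "Z \<in> borel_measurable M" unfolding Z_def by measurable
  have G_meas [measurable]: "G \<in> borel_measurable M" unfolding G_def by measurable
  have int: "integrable D (\<lambda>y. exp (g y a))" if a [measurable]: "a \<in> space M" for a
    by (rule D.integrable_const_bound[where B="exp B"]) (auto simp: g_bd)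
  have Z1: "1 \<le> Z a" if a: "a \<in> space M" for a
    using D.integral_ge_const[OF int[OF a], of 1] g_bd by (auto simp: Z_def)
  \<comment> \<open>Subtracting \<open>G a\<close> normalizes: for each \<open>a\<close> the tilt
    \<open>exp (g y a - G a)\<close> is a probability density in \<open>y\<close> with respect to
    \<open>D\<close>, so the exponential term of the pointwise inequality has total mass 1.\<close>
  have h1: "(\<integral>\<^sup>+y. ennreal (exp (g y a - G a)) \<partial>D) = 1" if a: "a \<in> space M" for a
  proof -
    have "(\<integral>\<^sup>+y. ennreal (exp (g y a - G a)) \<partial>D) = ennreal (\<integral>y. exp (g y a) / Z a \<partial>D)"
      using Z1[OF a] int[OF a]
      by (subst nn_integral_eq_integral[symmetric]) (auto simp: G_def exp_diff)
    also have "\<dots> = 1" using Z1[OF a] by (simp add: Z_def)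
    finally show ?thesis .
  qed
  have G0: "0 \<le> G a" if "a \<in> space M" for a using Z1[OF that] by (simp add: G_def)
  have ptw: "ennreal (p x a * g x a) + ennreal (p x' a)
     \<le> ennreal (p x a * G a) + ennreal (klint (p x a) (p x' a)) + ennreal (p x' a) * ennreal (exp (g x a - G a))"
    if "a \<in> space M" for x x' a
    using klint_change_of_measure[OF p_pos[of x a] p_pos[of x' a], of "g x a" "G a"]
      G0[OF that] p_pos[of x a] p_pos[of x' a] g_bd(1)[of x a] klint_nonneg[OF p_pos[of x a] p_pos[of x' a]]
    by (simp add: ennreal_plus[symmetric] ennreal_mult[symmetric] del: ennreal_plus)
  \<comment> \<open>The 1 on the left is the mass of \<open>p x'\<close>, the 1 on the right the
    mass of the tilted reference measure. Both are kept until the end, where a finite summand can be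
    cancelled in \<open>ennreal\<close>.\<close>
  have row: "(\<integral>\<^sup>+x. \<integral>\<^sup>+a. ennreal (p x a * g x a) \<partial>M \<partial>D) + 1
     \<le> (\<integral>\<^sup>+x. \<integral>\<^sup>+a. ennreal (p x a * G a) \<partial>M \<partial>D) + \<kappa> + 1" if x' [measurable]: "x' \<in> space D" for x'
  proof -
    have "(\<integral>\<^sup>+x. \<integral>\<^sup>+a. ennreal (p x a * g x a) \<partial>M \<partial>D) + 1
       = (\<integral>\<^sup>+x. (\<integral>\<^sup>+a. ennreal (p x a * g x a) \<partial>M) + (\<integral>\<^sup>+a. ennreal (p x' a) \<partial>M) \<partial>D)"
      by (subst nn_integral_add) (auto simp: p_one[OF x'] D.emeasure_space_1)
    also have "\<dots> = (\<integral>\<^sup>+x. (\<integral>\<^sup>+a. ennreal (p x a * g x a) + ennreal (p x' a) \<partial>M) \<partial>D)"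
      by (intro nn_integral_cong nn_integral_add[symmetric]) auto
    also have "\<dots> \<le> (\<integral>\<^sup>+x. (\<integral>\<^sup>+a. ennreal (p x a * G a) + ennreal (klint (p x a) (p x' a))
        + ennreal (p x' a) * ennreal (exp (g x a - G a)) \<partial>M) \<partial>D)"
      by (intro nn_integral_mono ptw)
    also have "\<dots> = (\<integral>\<^sup>+x. (\<integral>\<^sup>+a. ennreal (p x a * G a) \<partial>M) + (\<integral>\<^sup>+a. ennreal (klint (p x a) (p x' a)) \<partial>M)
        + (\<integral>\<^sup>+a. ennreal (p x' a) * ennreal (exp (g x a - G a)) \<partial>M) \<partial>D)"
      by (intro nn_integral_cong) (simp add: nn_integral_add)
    also have "\<dots> \<le> (\<integral>\<^sup>+x. (\<integral>\<^sup>+a. ennreal (p x a * G a) \<partial>M) + \<kappa>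
        + (\<integral>\<^sup>+a. ennreal (p x' a) * ennreal (exp (g x a - G a)) \<partial>M) \<partial>D)"
      by (intro nn_integral_mono add_mono kl x') auto
    also have "\<dots> = (\<integral>\<^sup>+x. \<integral>\<^sup>+a. ennreal (p x a * G a) \<partial>M \<partial>D) + \<kappa>
        + (\<integral>\<^sup>+x. \<integral>\<^sup>+a. ennreal (p x' a) * ennreal (exp (g x a - G a)) \<partial>M \<partial>D)"
      by (simp add: nn_integral_add D.emeasure_space_1)
    also have "(\<integral>\<^sup>+x. \<integral>\<^sup>+a. ennreal (p x' a) * ennreal (exp (g x a - G a)) \<partial>M \<partial>D)
       = (\<integral>\<^sup>+a. \<integral>\<^sup>+x. ennreal (p x' a) * ennreal (exp (g x a - G a)) \<partial>D \<partial>M)"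
      by (rule DM.Fubini'[symmetric]) measurable
    also have "\<dots> = (\<integral>\<^sup>+a. ennreal (p x' a) \<partial>M)"
      by (intro nn_integral_cong) (simp add: nn_integral_cmult h1)
    also have "\<dots> = 1" by (rule p_one[OF x'])
    finally show ?thesis .
  qed
  obtain x' where "x' \<in> space D" using D.not_empty by auto
  from row[OF this]
  have "(\<integral>\<^sup>+x. \<integral>\<^sup>+a. ennreal (p x a * g x a) \<partial>M \<partial>D)
     \<le> (\<integral>\<^sup>+x. \<integral>\<^sup>+a. ennreal (p x a * G a) \<partial>M \<partial>D) + \<kappa>"
    by (rule ennreal_add_right_le_cancel) simp
  then show ?thesis
    unfolding G_def Z_def by (subst add.commute)
qed

text \<open>
  Integrating out the last coordinate x of exp f leaves exp G, and the induction hypothesis is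
  applied to G for each frozen x; so no mixture of the densities p is ever formed.
\<close>
lemma tensorized_gibbs_variational_bound:
  fixes p f :: "(nat \<Rightarrow> 'x) \<Rightarrow> 'a \<Rightarrow> real" and \<kappa> :: ennreal
  assumes D: "prob_space D" and M: "sigma_finite_measure M"
    and "(\<lambda>(xs, a). p xs a) \<in> borel_measurable (PiM {..<n} (\<lambda>_. D) \<Otimes>\<^sub>M M)"
    and "\<And>xs a. p xs a > 0"
    and "\<And>xs. xs \<in> space (PiM {..<n} (\<lambda>_. D)) \<Longrightarrow> (\<integral>\<^sup>+a. p xs a \<partial>M) = 1"
    and "\<And>xs j x. xs \<in> space (PiM {..<n} (\<lambda>_. D)) \<Longrightarrow> j < n \<Longrightarrow> x \<in> space D \<Longrightarrow>
           (\<integral>\<^sup>+a. klint (p xs a) (p (xs(j := x)) a) \<partial>M) \<le> \<kappa>"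
    and "(\<lambda>(xs, a). f xs a) \<in> borel_measurable (PiM {..<n} (\<lambda>_. D) \<Otimes>\<^sub>M M)"
    and "\<And>xs a. 0 \<le> f xs a" and "\<And>xs a. f xs a \<le> B"
    and "C > 0"
    and "\<And>a. a \<in> space M \<Longrightarrow> (\<integral>\<^sup>+xs. ennreal (exp (f xs a)) \<partial>PiM {..<n} (\<lambda>_. D)) \<le> ennreal C"
  shows "(\<integral>\<^sup>+xs. \<integral>\<^sup>+a. ennreal (p xs a * f xs a) \<partial>M \<partial>PiM {..<n} (\<lambda>_. D)) \<le> of_nat n * \<kappa> + ennreal (ln C)"
  using assms(3-)
proof (induction n arbitrary: p f)
  case 0
  let ?u = "\<lambda>_::nat. undefined :: 'x"
  have u: "?u \<in> space (PiM {..<0} (\<lambda>_. D))" by (simp add: space_PiM)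
  have [measurable]: "(\<lambda>a. p ?u a) \<in> borel_measurable M" "(\<lambda>a. f ?u a) \<in> borel_measurable M"
    using measurable_Pair2[OF "0.prems"(1) u] measurable_Pair2[OF "0.prems"(5) u] by simp_all
  \<comment> \<open>With no coordinates left there is a single sample, so the exponential moment
    bound holds pointwise: \<open>exp f \<le> C\<close>.\<close>
  have le: "f ?u a \<le> ln C" if "a \<in> space M" for a
  proof -
    have "exp (f ?u a) \<le> C" using "0.prems"(9)[OF that] \<open>C > 0\<close>
      by (simp add: PiM_empty nn_integral_count_space_finite)
    then show ?thesis using \<open>C > 0\<close> by (simp add: ln_ge_iff)
  qed
  have "(\<integral>\<^sup>+a. ennreal (p ?u a * f ?u a) \<partial>M) \<le> (\<integral>\<^sup>+a. ennreal (p ?u a) * ennreal (ln C) \<partial>M)"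
    using le "0.prems"(2,6) by (intro nn_integral_mono)
      (auto simp: ennreal_mult'[symmetric] less_imp_le intro!: ennreal_leI mult_left_mono)
  also have "\<dots> = ennreal (ln C)" using "0.prems"(3)[OF u] by (simp add: nn_integral_multc)
  finally show ?case by (simp add: PiM_empty nn_integral_count_space_finite)
next
  case (Suc n)
  note [measurable] = Suc.prems(1) Suc.prems(5)
  note p_pos = Suc.prems(2) and p_one = Suc.prems(3) and kl = Suc.prems(4)
    and f0 = Suc.prems(6) and fB = Suc.prems(7) and mgf = Suc.prems(9)
  interpret D: prob_space D by fact
  interpret M: sigma_finite_measure M by fact
  interpret PD: product_prob_space "\<lambda>_. D" "{..<n}" ..
  interpret DP: pair_sigma_finite D "PiM {..<n} (\<lambda>_. D)" ..
  interpret PM: pair_sigma_finite "PiM {..<n} (\<lambda>_. D)" M ..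
  have ins: "{..<Suc n} = insert n {..<n}" by auto
  let ?P = "PiM {..<n} (\<lambda>_. D)"
  have upd [measurable]: "(\<lambda>(xs, x). xs(n := x)) \<in> ?P \<Otimes>\<^sub>M D \<rightarrow>\<^sub>M PiM {..<Suc n} (\<lambda>_. D)"
    unfolding ins by (rule measurable_add_dim)
  have upd_space: "xs(n := x) \<in> space (PiM {..<Suc n} (\<lambda>_. D))" if "xs \<in> space ?P" "x \<in> space D" for xs x
    using measurable_space[OF upd, of "(xs, x)"] that by (simp add: space_pair_measure)
  have fm [measurable]: "(\<lambda>w. f ((fst w)(n := fst (snd w))) (snd (snd w))) \<in> borel_measurable (?P \<Otimes>\<^sub>M D \<Otimes>\<^sub>M M)"
    by measurable
  have pm [measurable]: "(\<lambda>w. p ((fst w)(n := fst (snd w))) (snd (snd w))) \<in> borel_measurable (?P \<Otimes>\<^sub>M D \<Otimes>\<^sub>M M)"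
    by measurable
  define Z where "Z xs a = (\<integral>x. exp (f (xs(n := x)) a) \<partial>D)" for xs a
  \<comment> \<open>The bounds on \<open>Z\<close> hold only on the product space, whereas the
    induction hypothesis asks for bounds on all arguments; the default 0 lies within
    \<open>0\<close> and \<open>B\<close>.\<close>
  define G where "G xs a = (if xs \<in> space ?P \<and> a \<in> space M then ln (Z xs a) else 0)" for xs a
  have Zm [measurable]: "(\<lambda>(xs, a). Z xs a) \<in> borel_measurable (?P \<Otimes>\<^sub>M M)"
    unfolding Z_def by measurable
  have Gm [measurable]: "(\<lambda>(xs, a). G xs a) \<in> borel_measurable (?P \<Otimes>\<^sub>M M)"
    unfolding G_def by measurable
  have int: "integrable D (\<lambda>x. exp (f (xs(n := x)) a))" if [measurable]: "xs \<in> space ?P" "a \<in> space M" for xs a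
    by (rule D.integrable_const_bound[where B="exp B"]) (auto simp: fB)
  have Z1: "1 \<le> Z xs a" if "xs \<in> space ?P" "a \<in> space M" for xs a
    using D.integral_ge_const[OF int[OF that], of 1] f0 by (auto simp: Z_def)
  have ZB: "Z xs a \<le> exp B" if "xs \<in> space ?P" "a \<in> space M" for xs a
    using D.integral_le_const[OF int[OF that], of "exp B"] fB by (auto simp: Z_def)
  have B0: "0 \<le> B" using f0 fB order_trans by blast
  have G0: "0 \<le> G xs a" for xs a using Z1 by (auto simp: G_def)
  have GB: "G xs a \<le> B" for xs a
  proof (cases "xs \<in> space ?P \<and> a \<in> space M")
    case True
    then show ?thesis using Z1[of xs a] ZB[of xs a] by (simp add: G_def) (metis exp_gt_zero ln_exp ln_le_cancel_iff less_le_trans zero_less_one)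
  qed (use B0 in \<open>auto simp: G_def\<close>)
  \<comment> \<open>Passing from \<open>f\<close> to \<open>G\<close> preserves the exponential
    moment, so the same \<open>C\<close> survives every step and only multiples of
    \<open>\<kappa>\<close> accumulate.\<close>
  have expG: "(\<integral>\<^sup>+xs. ennreal (exp (G xs a)) \<partial>?P) \<le> ennreal C" if [measurable]: "a \<in> space M" for a
  proof -
    have "(\<integral>\<^sup>+xs. ennreal (exp (G xs a)) \<partial>?P) = (\<integral>\<^sup>+xs. \<integral>\<^sup>+x. ennreal (exp (f (xs(n := x)) a)) \<partial>D \<partial>?P)"
    proof (intro nn_integral_cong)
      fix xs assume xs: "xs \<in> space ?P"
      show "ennreal (exp (G xs a)) = (\<integral>\<^sup>+x. ennreal (exp (f (xs(n := x)) a)) \<partial>D)"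
        using Z1[OF xs that] xs that by (subst nn_integral_eq_integral[OF int]) (auto simp: G_def Z_def)
    qed
    also have "\<dots> = (\<integral>\<^sup>+xs. ennreal (exp (f xs a)) \<partial>PiM (insert n {..<n}) (\<lambda>_. D))"
      by (rule PD.product_nn_integral_insert[symmetric]) (auto simp: ins[symmetric])
    also have "\<dots> \<le> ennreal C" using mgf[OF that] by (simp add: ins)
    finally show ?thesis .
  qed
  have "(\<integral>\<^sup>+xs. \<integral>\<^sup>+a. ennreal (p xs a * f xs a) \<partial>M \<partial>PiM {..<Suc n} (\<lambda>_. D))
     = (\<integral>\<^sup>+xs. \<integral>\<^sup>+x. \<integral>\<^sup>+a. ennreal (p (xs(n := x)) a * f (xs(n := x)) a) \<partial>M \<partial>D \<partial>?P)"
    unfolding ins by (rule PD.product_nn_integral_insert) (auto simp: ins[symmetric])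
  also have "\<dots> \<le> (\<integral>\<^sup>+xs. \<kappa> + (\<integral>\<^sup>+x. \<integral>\<^sup>+a. ennreal (p (xs(n := x)) a * G xs a) \<partial>M \<partial>D) \<partial>?P)"
  proof (rule nn_integral_mono)
    fix xs assume xs [measurable]: "xs \<in> space ?P"
    have "(\<integral>\<^sup>+x. \<integral>\<^sup>+a. ennreal (p (xs(n := x)) a * f (xs(n := x)) a) \<partial>M \<partial>D)
      \<le> \<kappa> + (\<integral>\<^sup>+x. \<integral>\<^sup>+a. ennreal (p (xs(n := x)) a * ln (Z xs a)) \<partial>M \<partial>D)"
      unfolding Z_def
    proof (rule gibbs_variational_bound[OF D M, where B=B])
      show "(\<lambda>(x, a). p (xs(n := x)) a) \<in> borel_measurable (D \<Otimes>\<^sub>M M)"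
        using measurable_Pair2[OF pm xs] by (simp add: case_prod_beta')
      show "(\<lambda>(x, a). f (xs(n := x)) a) \<in> borel_measurable (D \<Otimes>\<^sub>M M)"
        using measurable_Pair2[OF fm xs] by (simp add: case_prod_beta')
      show "(\<integral>\<^sup>+ a. ennreal (klint (p (xs(n := x)) a) (p (xs(n := x')) a)) \<partial>M) \<le> \<kappa>"
        if "x \<in> space D" "x' \<in> space D" for x x'
        using kl[OF upd_space[OF xs that(1)] lessI that(2)] unfolding fun_upd_upd .
      show "(\<integral>\<^sup>+ a. ennreal (p (xs(n := x)) a) \<partial>M) = 1" if "x \<in> space D" for x
        by (rule p_one[OF upd_space[OF xs that]])
    qed (use p_pos f0 fB in auto)
    also have "(\<integral>\<^sup>+x. \<integral>\<^sup>+a. ennreal (p (xs(n := x)) a * ln (Z xs a)) \<partial>M \<partial>D)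
      = (\<integral>\<^sup>+x. \<integral>\<^sup>+a. ennreal (p (xs(n := x)) a * G xs a) \<partial>M \<partial>D)"
      using xs by (intro nn_integral_cong) (simp add: G_def)
    finally show "(\<integral>\<^sup>+x. \<integral>\<^sup>+a. ennreal (p (xs(n := x)) a * f (xs(n := x)) a) \<partial>M \<partial>D)
      \<le> \<kappa> + (\<integral>\<^sup>+x. \<integral>\<^sup>+a. ennreal (p (xs(n := x)) a * G xs a) \<partial>M \<partial>D)" .
  qed
  also have "\<dots> = \<kappa> + (\<integral>\<^sup>+xs. \<integral>\<^sup>+x. \<integral>\<^sup>+a. ennreal (p (xs(n := x)) a * G xs a) \<partial>M \<partial>D \<partial>?P)"
    by (subst nn_integral_add) (auto simp: PD.emeasure_space_1)
  \<comment> \<open>Moving \<open>x\<close> outermost is possible because \<open>G\<close> no longer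
    depends on it: for frozen \<open>x\<close> the remaining problem has \<open>n\<close>
    coordinates and the test function \<open>G\<close>.\<close>
  also have "(\<integral>\<^sup>+xs. \<integral>\<^sup>+x. \<integral>\<^sup>+a. ennreal (p (xs(n := x)) a * G xs a) \<partial>M \<partial>D \<partial>?P)
     = (\<integral>\<^sup>+x. \<integral>\<^sup>+xs. \<integral>\<^sup>+a. ennreal (p (xs(n := x)) a * G xs a) \<partial>M \<partial>?P \<partial>D)"
    by (intro DP.Fubini') measurable
  also have "\<dots> \<le> (\<integral>\<^sup>+x. of_nat n * \<kappa> + ennreal (ln C) \<partial>D)"
  proof (rule nn_integral_mono)
    fix x assume x [measurable]: "x \<in> space D"
    show "(\<integral>\<^sup>+xs. \<integral>\<^sup>+a. ennreal (p (xs(n := x)) a * G xs a) \<partial>M \<partial>?P) \<le> of_nat n * \<kappa> + ennreal (ln C)"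
    proof (rule Suc.IH)
      show "(\<lambda>(xs, a). p (xs(n := x)) a) \<in> borel_measurable (?P \<Otimes>\<^sub>M M)"
        by measurable
      show "(\<integral>\<^sup>+ a. ennreal (klint (p (xs(n := x)) a) (p (xs(j := y, n := x)) a)) \<partial>M) \<le> \<kappa>"
        if "xs \<in> space ?P" "j < n" "y \<in> space D" for xs j y
      proof -
        have "xs(j := y, n := x) = xs(n := x, j := y)" using that(2) by (intro fun_upd_twist) simp
        then show ?thesis
          using kl[OF upd_space[OF that(1) x] less_SucI[OF that(2)] that(3)] by (simp only:)
      qed
      show "(\<integral>\<^sup>+ a. ennreal (p (xs(n := x)) a) \<partial>M) = 1" if "xs \<in> space ?P" for xs
        by (rule p_one[OF upd_space[OF that x]])
    qed (use p_pos G0 GB Gm expG \<open>C > 0\<close> in auto)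
  qed
  also have "\<dots> = of_nat n * \<kappa> + ennreal (ln C)" by (simp add: D.emeasure_space_1)
  finally show ?case by (simp add: algebra_simps)
qed

section \<open>Densities of Gaussian transcripts\<close>

text \<open>\<open>m i h\<close> is the mean of answer \<open>i\<close> after history
  \<open>h\<close>, so this is the joint density as a product of conditional densities. Restricting
  to \<open>{..<i}\<close> follows the convention of \<open>hist\<close>, undefined from index
  \<open>i\<close> on, and lands in the space where queries are assumed measurable.\<close>

definition transcript_density :: "real \<Rightarrow> (nat \<Rightarrow> (nat \<Rightarrow> real) \<Rightarrow> real) \<Rightarrow> nat \<Rightarrow> (nat \<Rightarrow> real) \<Rightarrow> real" where
  "transcript_density \<sigma> m k a = (\<Prod>i<k. normal_density 0 \<sigma> (a i - m i (restrict a {..<i})))"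

lemma sets_PiM_lborel [measurable_cong]: "sets (PiM I (\<lambda>_. lborel :: real measure)) = sets (PiM I (\<lambda>_. borel))"
  by (intro sets_PiM_cong) auto

lemma transcript_density_pos: "\<sigma> > 0 \<Longrightarrow> transcript_density \<sigma> m k a > 0"
  unfolding transcript_density_def by (intro prod_pos) (auto intro: normal_density_pos)

lemma transcript_density_0 [simp]: "transcript_density \<sigma> m 0 a = 1"
  by (simp add: transcript_density_def)

text \<open>Earlier factors do not see coordinate \<open>k\<close>. Extensionality gives
  \<open>restrict a {..<k} = a\<close>, so the history of the last round is \<open>a\<close>
  itself.\<close>

lemma transcript_density_Suc:
  assumes "a \<in> extensional {..<k}"
  shows "transcript_density \<sigma> m (Suc k) (a(k := y)) = transcript_density \<sigma> m k a * normal_density (m k a) \<sigma> y"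
proof -
  have r: "restrict (a(k := y)) {..<i} = restrict a {..<i}" if "i \<le> k" for i
    using that by (auto simp: restrict_def)
  have "(\<Prod>i<k. normal_density 0 \<sigma> ((a(k := y)) i - m i (restrict (a(k := y)) {..<i})))
      = (\<Prod>i<k. normal_density 0 \<sigma> (a i - m i (restrict a {..<i})))"
    by (intro prod.cong) (auto simp: r less_imp_le)
  moreover have "restrict a {..<k} = a" using assms by (rule extensional_restrict)
  ultimately show ?thesis
    by (simp add: transcript_density_def r normal_density_def)
qed

lemma measurable_transcript_density [measurable]:
  assumes [measurable]: "\<And>i. m i \<in> borel_measurable (PiM {..<i} (\<lambda>_. borel))"
  shows "transcript_density \<sigma> m k \<in> borel_measurable (PiM {..<k} (\<lambda>_. borel))"
proof -
  have [measurable]: "(\<lambda>a. restrict a {..<i}) \<in> PiM {..<k} (\<lambda>_. borel) \<rightarrow>\<^sub>M PiM {..<i} (\<lambda>_. borel)" if "i < k" for i :: nat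
    using that by (intro measurable_restrict_subset) auto
  show ?thesis unfolding transcript_density_def[abs_def] by measurable
qed

lemma measurable_fun_upd_last:
  "(\<lambda>(a, y). a(k := y)) \<in> PiM {..<k} (\<lambda>_. M) \<Otimes>\<^sub>M M \<rightarrow>\<^sub>M PiM {..<Suc k} (\<lambda>_. M)"
  unfolding lessThan_Suc by (rule measurable_add_dim)

lemma nn_integral_PiM_Suc:
  assumes "sigma_finite_measure M" "f \<in> borel_measurable (PiM {..<Suc k} (\<lambda>_. M))"
  shows "(\<integral>\<^sup>+a. f a \<partial>PiM {..<Suc k} (\<lambda>_. M)) = (\<integral>\<^sup>+a. \<integral>\<^sup>+y. f (a(k := y)) \<partial>M \<partial>PiM {..<k} (\<lambda>_. M))"
proof -
  interpret sigma_finite_measure M by fact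
  interpret product_sigma_finite "\<lambda>_::nat. M" ..
  show ?thesis
    using product_nn_integral_insert[of "{..<k}" k f] assms(2) by (simp add: lessThan_Suc)
qed

lemma nn_integral_normal_density: "\<sigma> > 0 \<Longrightarrow> (\<integral>\<^sup>+y. normal_density \<mu> \<sigma> y \<partial>lborel) = 1"
  by (subst nn_integral_eq_integral) auto

text \<open>For equal variances the log-ratio is affine in \<open>y\<close>, so the relative entropy
  needs only the first central moment.\<close>

lemma nn_integral_klint_normal_density:
  assumes "\<sigma> > 0"
  shows "(\<integral>\<^sup>+y. klint (normal_density s \<sigma> y) (normal_density t \<sigma> y) \<partial>lborel) = ennreal ((s - t)\<^sup>2 / (2 * \<sigma>\<^sup>2))"
proof -
  have log_ratio: "ln (normal_density s \<sigma> y / normal_density t \<sigma> y)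
      = (2 * (y - s) * (s - t) + (s - t)\<^sup>2) / (2 * \<sigma>\<^sup>2)" for y
  proof -
    have "normal_density s \<sigma> y / normal_density t \<sigma> y
       = exp (- (y - s)\<^sup>2 / (2 * \<sigma>\<^sup>2)) / exp (- (y - t)\<^sup>2 / (2 * \<sigma>\<^sup>2))"
      using assms by (simp add: normal_density_def)
    also have "\<dots> = exp (- (y - s)\<^sup>2 / (2 * \<sigma>\<^sup>2) + (y - t)\<^sup>2 / (2 * \<sigma>\<^sup>2))"
      by (simp add: exp_diff[symmetric])
    also have "- (y - s)\<^sup>2 / (2 * \<sigma>\<^sup>2) + (y - t)\<^sup>2 / (2 * \<sigma>\<^sup>2) = (2 * (y - s) * (s - t) + (s - t)\<^sup>2) / (2 * \<sigma>\<^sup>2)"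
      by (simp add: add_divide_distrib[symmetric] power2_eq_square algebra_simps)
    finally show ?thesis by simp
  qed
  let ?c = "(s - t) / \<sigma>\<^sup>2" and ?d = "(s - t)\<^sup>2 / (2 * \<sigma>\<^sup>2)"
  have eq: "klint (normal_density s \<sigma> y) (normal_density t \<sigma> y) =
      ?c * (normal_density s \<sigma> y * (y - s)) + (?d - 1) * normal_density s \<sigma> y + normal_density t \<sigma> y" for y
    unfolding klint_def log_ratio using assms by (simp add: field_simps)
  \<comment> \<open>The three summands are the vanishing first central moment and the two unit
    masses; the corrections in \<open>klint\<close> cancel, leaving \<open>?d\<close>.\<close>
  have "has_bochner_integral lborel (\<lambda>y. klint (normal_density s \<sigma> y) (normal_density t \<sigma> y))
     (?c * 0 + (?d - 1) * 1 + 1)"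
    unfolding eq using assms normal_moment_odd[OF assms, of s 0]
    by (intro has_bochner_integral_add has_bochner_integral_mult_right)
      (auto simp: has_bochner_integral_iff)
  then have "has_bochner_integral lborel (\<lambda>y. klint (normal_density s \<sigma> y) (normal_density t \<sigma> y)) ?d"
    by simp
  moreover have "0 \<le> klint (normal_density s \<sigma> y) (normal_density t \<sigma> y)" for y
    using assms by (intro klint_nonneg normal_density_pos)
  ultimately show ?thesis
    by (subst nn_integral_eq_integral) (auto simp: has_bochner_integral_iff)
qed

lemma nn_integral_transcript_density:
  assumes "\<sigma> > 0" and m: "\<And>i. m i \<in> borel_measurable (PiM {..<i} (\<lambda>_. borel))"
  shows "(\<integral>\<^sup>+a. transcript_density \<sigma> m k a \<partial>PiM {..<k} (\<lambda>_. lborel)) = 1"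
proof (induction k)
  case 0
  then show ?case by (simp add: PiM_empty nn_integral_count_space_finite)
next
  case (Suc k)
  note [measurable] = measurable_transcript_density[OF m]
  have "(\<integral>\<^sup>+a. transcript_density \<sigma> m (Suc k) a \<partial>PiM {..<Suc k} (\<lambda>_. lborel))
     = (\<integral>\<^sup>+a. \<integral>\<^sup>+y. ennreal (transcript_density \<sigma> m (Suc k) (a(k := y))) \<partial>lborel \<partial>PiM {..<k} (\<lambda>_. lborel))"
    by (rule nn_integral_PiM_Suc) (auto intro: sigma_finite_lborel)
  also have "\<dots> = (\<integral>\<^sup>+a. transcript_density \<sigma> m k a \<partial>PiM {..<k} (\<lambda>_. lborel))"
    using assms(1) by (intro nn_integral_cong)
      (simp add: transcript_density_Suc space_PiM PiE_def transcript_density_pos less_imp_le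
        ennreal_mult nn_integral_cmult nn_integral_normal_density)
  finally show ?case using Suc.IH by simp
qed

text \<open>By the chain rule each round adds its conditional entropy, at most
  \<open>d\<^sup>2 / (2 * \<sigma>\<^sup>2)\<close>. Closeness of the means is uniform over
  histories, so adaptivity does not increase the cost.\<close>

lemma nn_integral_klint_transcript_density:
  assumes "\<sigma> > 0"
    and m: "\<And>i. m i \<in> borel_measurable (PiM {..<i} (\<lambda>_. borel))"
    and m': "\<And>i. m' i \<in> borel_measurable (PiM {..<i} (\<lambda>_. borel))"
    and close: "\<And>i h. \<bar>m i h - m' i h\<bar> \<le> d"
  shows "(\<integral>\<^sup>+a. klint (transcript_density \<sigma> m k a) (transcript_density \<sigma> m' k a) \<partial>PiM {..<k} (\<lambda>_. lborel))
    \<le> ennreal (real k * (d\<^sup>2 / (2 * \<sigma>\<^sup>2)))"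
proof (induction k)
  case 0
  then show ?case by (simp add: PiM_empty nn_integral_count_space_finite klint_def)
next
  case (Suc k)
  note [measurable] = measurable_transcript_density[OF m] measurable_transcript_density[OF m']
  let ?L = "PiM {..<k} (\<lambda>_. lborel :: real measure)"
  let ?p = "transcript_density \<sigma> m" and ?q = "transcript_density \<sigma> m'" and ?e = "d\<^sup>2 / (2 * \<sigma>\<^sup>2)"
  have d: "0 \<le> d" using close[of 0 undefined] by linarith
  have step: "(\<integral>\<^sup>+y. klint (?p (Suc k) (a(k := y))) (?q (Suc k) (a(k := y))) \<partial>lborel)
     \<le> ennreal (klint (?p k a) (?q k a)) + ennreal (?p k a) * ennreal ?e" if a: "a \<in> space ?L" for a
  proof -
    define u where "u = ?p k a"
    define v where "v = ?q k a"
    define s where "s = normal_density (m k a) \<sigma>"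
    define t where "t = normal_density (m' k a) \<sigma>"
    have [measurable]: "s \<in> borel_measurable borel" "t \<in> borel_measurable borel" by (auto simp: s_def t_def)
    have pos: "u > 0" "v > 0" "\<And>y. s y > 0" "\<And>y. t y > 0"
      using assms(1) by (auto simp: u_def v_def s_def t_def transcript_density_pos normal_density_pos)
    have kn: "0 \<le> klint u v" "\<And>y. 0 \<le> klint (s y) (t y)" "\<And>y. 0 \<le> klint (u * s y) (v * t y)"
      using pos by (auto intro!: klint_nonneg)
    have one: "(\<integral>\<^sup>+y. s y \<partial>lborel) = 1" "(\<integral>\<^sup>+y. t y \<partial>lborel) = 1"
      using assms(1) by (auto simp: s_def t_def nn_integral_normal_density)
    have "a \<in> extensional {..<k}" using a by (simp add: space_PiM PiE_def)
    then have "(\<integral>\<^sup>+y. klint (?p (Suc k) (a(k := y))) (?q (Suc k) (a(k := y))) \<partial>lborel)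
       = (\<integral>\<^sup>+y. klint (u * s y) (v * t y) \<partial>lborel)"
      by (simp add: transcript_density_Suc u_def v_def s_def t_def)
    \<comment> \<open>The summand \<open>v + u\<close> is what the correction terms of
      \<open>klint_mult\<close> integrate to; being finite, it is cancelled right
      afterwards.\<close>
    moreover have "(\<integral>\<^sup>+y. klint (u * s y) (v * t y) \<partial>lborel) + (ennreal v + ennreal u)
       = ennreal (klint u v) + ennreal u * (\<integral>\<^sup>+y. klint (s y) (t y) \<partial>lborel) + (ennreal v + ennreal u)"
    proof -
      have "(\<integral>\<^sup>+y. klint (u * s y) (v * t y) \<partial>lborel) + (ennreal v + ennreal u)
         = (\<integral>\<^sup>+y. ennreal (klint (u * s y) (v * t y)) + (ennreal v * ennreal (s y) + ennreal u * ennreal (t y)) \<partial>lborel)"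
        by (simp add: nn_integral_add nn_integral_cmult one)
      also have "\<dots> = (\<integral>\<^sup>+y. ennreal (klint u v) * ennreal (s y) + ennreal u * ennreal (klint (s y) (t y))
           + (ennreal v * ennreal (t y) + ennreal u * ennreal (s y)) \<partial>lborel)"
      proof (intro nn_integral_cong)
        fix y
        show "ennreal (klint (u * s y) (v * t y)) + (ennreal v * ennreal (s y) + ennreal u * ennreal (t y))
          = ennreal (klint u v) * ennreal (s y) + ennreal u * ennreal (klint (s y) (t y))
           + (ennreal v * ennreal (t y) + ennreal u * ennreal (s y))"
          using klint_mult[OF pos(1,2) pos(3)[of y] pos(4)[of y]] kn pos(1,2) pos(3)[of y] pos(4)[of y]
          by (simp add: ennreal_plus[symmetric] ennreal_mult[symmetric] add.assoc del: ennreal_plus)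
      qed
      also have "\<dots> = ennreal (klint u v) + ennreal u * (\<integral>\<^sup>+y. klint (s y) (t y) \<partial>lborel) + (ennreal v + ennreal u)"
        by (simp add: nn_integral_add nn_integral_cmult one)
      finally show ?thesis .
    qed
    ultimately have "(\<integral>\<^sup>+y. klint (?p (Suc k) (a(k := y))) (?q (Suc k) (a(k := y))) \<partial>lborel) + (ennreal v + ennreal u)
       = ennreal (klint u v) + ennreal u * (\<integral>\<^sup>+y. klint (s y) (t y) \<partial>lborel) + (ennreal v + ennreal u)"
      by (simp only:)
    from eq_refl[OF this]
    have "(\<integral>\<^sup>+y. klint (?p (Suc k) (a(k := y))) (?q (Suc k) (a(k := y))) \<partial>lborel)
       \<le> ennreal (klint u v) + ennreal u * (\<integral>\<^sup>+y. klint (s y) (t y) \<partial>lborel)"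
      by (rule ennreal_add_right_le_cancel) simp
    also have "(\<integral>\<^sup>+y. klint (s y) (t y) \<partial>lborel) \<le> ennreal ?e"
      unfolding s_def t_def nn_integral_klint_normal_density[OF assms(1)]
      using close[of k a] d assms(1)
      by (intro ennreal_leI divide_right_mono) (auto simp: abs_le_square_iff[symmetric])
    finally show ?thesis by (simp add: u_def v_def add_mono mult_left_mono)
  qed
  have "(\<integral>\<^sup>+a. klint (?p (Suc k) a) (?q (Suc k) a) \<partial>PiM {..<Suc k} (\<lambda>_. lborel))
     = (\<integral>\<^sup>+a. \<integral>\<^sup>+y. klint (?p (Suc k) (a(k := y))) (?q (Suc k) (a(k := y))) \<partial>lborel \<partial>?L)"
    by (rule nn_integral_PiM_Suc) (auto intro: sigma_finite_lborel)
  also have "\<dots> \<le> (\<integral>\<^sup>+a. ennreal (klint (?p k a) (?q k a)) + ennreal (?p k a) * ennreal ?e \<partial>?L)"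
    by (intro nn_integral_mono step)
  also have "\<dots> = (\<integral>\<^sup>+a. klint (?p k a) (?q k a) \<partial>?L) + ennreal ?e"
    by (simp add: nn_integral_add nn_integral_multc nn_integral_transcript_density[OF assms(1) m])
  also have "\<dots> \<le> ennreal (real k * ?e) + ennreal ?e" by (intro add_right_mono Suc.IH)
  also have "\<dots> = ennreal (real (Suc k) * ?e)"
    by (subst ennreal_plus[symmetric]) (auto simp: distrib_right add_divide_distrib simp del: ennreal_plus)
  finally show ?case .
qed

section \<open>The law of the interaction transcript\<close>

lemma hist_cong: "(\<And>i. i < k \<Longrightarrow> z i = z' i) \<Longrightarrow> hist n Q r xs z k = hist n Q r xs z' k"
  by (induction k) auto

lemma measurable_hist:
  assumes [measurable]: "\<And>i. (\<lambda>h. emp_mean n (Q i h r) xs) \<in> borel_measurable (PiM {..<i} (\<lambda>_. borel))"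
    and "k \<le> K"
  shows "(\<lambda>z. hist n Q r xs z k) \<in> PiM {..<K} (\<lambda>_. borel) \<rightarrow>\<^sub>M PiM {..<k} (\<lambda>_. borel)"
  using \<open>k \<le> K\<close>
proof (induction k)
  case 0
  then show ?case by (simp add: PiM_empty measurable_const)
next
  case (Suc k)
  then have [measurable]: "(\<lambda>z. hist n Q r xs z k) \<in> PiM {..<K} (\<lambda>_. borel) \<rightarrow>\<^sub>M PiM {..<k} (\<lambda>_. borel)"
    "(\<lambda>z. z k) \<in> borel_measurable (PiM {..<K} (\<lambda>_. borel))"
    by (auto intro!: measurable_component_singleton)
  show ?case
    unfolding hist.simps
    using measurable_compose[OF measurable_Pair measurable_fun_upd_last,
      of "\<lambda>z. hist n Q r xs z k" "PiM {..<K} (\<lambda>_. borel)" k borel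
        "\<lambda>z. emp_mean n (Q k (hist n Q r xs z k) r) xs + z k"]
    unfolding prod.case by measurable
qed

text \<open>Given the first \<open>k\<close> answers, the next one is fresh noise shifted by a mean
  they determine. Integrating out the last noise variable leaves the function \<open>H\<close> of
  the shorter history, to which the induction hypothesis applies.\<close>

lemma nn_integral_hist:
  assumes "\<sigma> > 0"
    and m: "\<And>i. (\<lambda>h. emp_mean n (Q i h r) xs) \<in> borel_measurable (PiM {..<i} (\<lambda>_. borel))"
    and F: "F \<in> borel_measurable (PiM {..<k} (\<lambda>_. borel))"
  shows "(\<integral>\<^sup>+z. F (hist n Q r xs z k) \<partial>PiM {..<k} (\<lambda>_. density lborel (normal_density 0 \<sigma>)))
    = (\<integral>\<^sup>+a. ennreal (transcript_density \<sigma> (\<lambda>i h. emp_mean n (Q i h r) xs) k a) * F a \<partial>PiM {..<k} (\<lambda>_. lborel))"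
  using F
proof (induction k arbitrary: F)
  case 0
  then show ?case by (simp add: PiM_empty nn_integral_count_space_finite)
next
  case (Suc k)
  let ?m = "\<lambda>i h. emp_mean n (Q i h r) xs"
  let ?N = "density lborel (normal_density 0 \<sigma>)"
  have [measurable_cong]: "sets (PiM I (\<lambda>_. ?N)) = sets (PiM I (\<lambda>_. borel))" for I :: "nat set"
    by (intro sets_PiM_cong) auto
  note [measurable] = Suc.prems measurable_transcript_density[OF m] m measurable_hist[where n=n and Q=Q and r=r and xs=xs, OF m order_refl]
    measurable_fun_upd_last
  have N: "sigma_finite_measure ?N"
    using prob_space_normal_density[OF assms(1)] by (simp add: prob_space_imp_sigma_finite)
  define H where "H a = (\<integral>\<^sup>+y. ennreal (normal_density (?m k a) \<sigma> y) * F (a(k := y)) \<partial>lborel)" for a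
  have nd [measurable]: "(\<lambda>(a, y). normal_density (?m k a) \<sigma> y) \<in> borel_measurable (PiM {..<k} (\<lambda>_. borel) \<Otimes>\<^sub>M borel)"
    unfolding normal_density_def by measurable
  have Hm: "H \<in> borel_measurable (PiM {..<k} (\<lambda>_. borel))"
    unfolding H_def by measurable
  have "(\<integral>\<^sup>+z. F (hist n Q r xs z (Suc k)) \<partial>PiM {..<Suc k} (\<lambda>_. ?N))
     = (\<integral>\<^sup>+z. \<integral>\<^sup>+y. F (hist n Q r xs (z(k := y)) (Suc k)) \<partial>?N \<partial>PiM {..<k} (\<lambda>_. ?N))"
    by (rule nn_integral_PiM_Suc[OF N]) measurable
  also have "\<dots> = (\<integral>\<^sup>+z. H (hist n Q r xs z k) \<partial>PiM {..<k} (\<lambda>_. ?N))"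
  proof (intro nn_integral_cong)
    fix z assume z: "z \<in> space (PiM {..<k} (\<lambda>_. ?N))"
    let ?h = "hist n Q r xs z k"
    have h: "hist n Q r xs (z(k := y)) k = ?h" for y by (rule hist_cong) auto
    have hs [measurable]: "?h \<in> space (PiM {..<k} (\<lambda>_. borel))"
      using measurable_space[OF measurable_hist[where n=n and Q=Q and r=r and xs=xs and k=k, OF m order_refl], of z] z by (simp add: space_PiM)
    have "(\<integral>\<^sup>+y. F (hist n Q r xs (z(k := y)) (Suc k)) \<partial>?N)
       = (\<integral>\<^sup>+y. ennreal (normal_density 0 \<sigma> y) * F (?h(k := ?m k ?h + y)) \<partial>lborel)"
      unfolding hist.simps h fun_upd_same by (subst nn_integral_density) auto
    \<comment> \<open>Translation invariance of Lebesgue measure replaces the noise by the answer as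
      integration variable.\<close>
    also have "\<dots> = H ?h"
      unfolding H_def
      by (subst (2) nn_integral_real_affine[where c=1 and t="?m k ?h"])
        (auto simp: normal_density_def)
    finally show "(\<integral>\<^sup>+y. F (hist n Q r xs (z(k := y)) (Suc k)) \<partial>?N) = H ?h" .
  qed
  also have "\<dots> = (\<integral>\<^sup>+a. ennreal (transcript_density \<sigma> ?m k a) * H a \<partial>PiM {..<k} (\<lambda>_. lborel))"
    by (rule Suc.IH[OF Hm])
  also have "\<dots> = (\<integral>\<^sup>+a. \<integral>\<^sup>+y. ennreal (transcript_density \<sigma> ?m (Suc k) (a(k := y))) * F (a(k := y)) \<partial>lborel \<partial>PiM {..<k} (\<lambda>_. lborel))"
  proof (intro nn_integral_cong)
    fix a assume "a \<in> space (PiM {..<k} (\<lambda>_. lborel :: real measure))"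
    then have [measurable]: "a \<in> space (PiM {..<k} (\<lambda>_. borel))" and e: "a \<in> extensional {..<k}"
      by (auto simp: space_PiM PiE_def)
    show "ennreal (transcript_density \<sigma> ?m k a) * H a
      = (\<integral>\<^sup>+y. ennreal (transcript_density \<sigma> ?m (Suc k) (a(k := y))) * F (a(k := y)) \<partial>lborel)"
      unfolding H_def transcript_density_Suc[OF e]
      using transcript_density_pos[OF assms(1), of ?m k a]
      by (subst nn_integral_cmult[symmetric]) (auto simp: ennreal_mult mult.assoc)
  qed
  also have "\<dots> = (\<integral>\<^sup>+a. ennreal (transcript_density \<sigma> ?m (Suc k) a) * F a \<partial>PiM {..<Suc k} (\<lambda>_. lborel))"
    by (rule nn_integral_PiM_Suc[symmetric]) (auto intro: sigma_finite_lborel)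
  finally show ?case .
qed

section \<open>Subgaussian concentration of the empirical mean\<close>

lemma nn_integral_std_normal_exp:
  "(\<integral>\<^sup>+y. ennreal (std_normal_density y * exp (s * y)) \<partial>lborel) = ennreal (exp (s\<^sup>2 / 2))"
proof -
  have eq: "std_normal_density y * exp (s * y) = exp (s\<^sup>2 / 2) * normal_density s 1 y" for y
    by (simp add: normal_density_def exp_add[symmetric] power2_eq_square field_simps)
  show ?thesis unfolding eq
    by (subst ennreal_mult) (auto simp: nn_integral_cmult nn_integral_normal_density)
qed

text \<open>The weight only rescales the Gaussian: the integrand is \<open>1 / sqrt (1 - t)\<close>
  times the normal density of variance \<open>1 / (1 - t)\<close>. This factor is the source of
  \<open>ln (1 - t)\<close> in the final bound.\<close>

lemma nn_integral_std_normal_exp_square: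
  assumes "t < 1"
  shows "(\<integral>\<^sup>+y. ennreal (std_normal_density y * exp (t * y\<^sup>2 / 2)) \<partial>lborel) = ennreal (1 / sqrt (1 - t))"
proof -
  let ?s = "1 / sqrt (1 - t)"
  have eq: "std_normal_density y * exp (t * y\<^sup>2 / 2) = ?s * normal_density 0 ?s y" for y
  proof -
    have "- y\<^sup>2 / 2 + t * y\<^sup>2 / 2 = - y\<^sup>2 / (2 * ?s\<^sup>2)"
      using assms by (simp add: power_divide field_simps)
    then have "std_normal_density y * exp (t * y\<^sup>2 / 2) = 1 / sqrt (2 * pi) * exp (- y\<^sup>2 / (2 * ?s\<^sup>2))"
      by (simp add: std_normal_density_def exp_add[symmetric])
    also have "1 / sqrt (2 * pi) = ?s * (1 / sqrt (2 * pi * ?s\<^sup>2))"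
      using assms by (simp add: real_sqrt_mult real_sqrt_divide power_divide)
    finally show ?thesis by (simp add: normal_density_def)
  qed
  show ?thesis unfolding eq using assms
    by (subst ennreal_mult) (auto simp: nn_integral_cmult nn_integral_normal_density)
qed

text \<open>Hoeffding's lemma covers \<open>l > 0\<close>; negative \<open>l\<close> is reduced to
  it by reflecting \<open>q\<close> into \<open>{-1..0}\<close>. Both signs are needed because
  \<open>l\<close> will be multiplied by a Gaussian variable.\<close>

lemma (in prob_space) nn_integral_exp_centered_unit_interval:
  fixes q :: "'a \<Rightarrow> real"
  assumes [measurable]: "q \<in> borel_measurable M" and q: "\<And>x. 0 \<le> q x" "\<And>x. q x \<le> 1"
  shows "(\<integral>\<^sup>+x. ennreal (exp (l * (q x - expectation q))) \<partial>M) \<le> ennreal (exp (l\<^sup>2 / 8))"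
proof -
  have *: "(\<integral>\<^sup>+x. ennreal (exp (l * (f x - expectation f))) \<partial>M) \<le> ennreal (exp (l\<^sup>2 * (b - a)\<^sup>2 / 8))"
    if "l > 0" "f \<in> borel_measurable M" "\<And>x. f x \<in> {a..b}" for l a b and f :: "'a \<Rightarrow> real"
  proof -
    interpret interval_bounded_random_variable M f a b
      using that by unfold_locales auto
    show ?thesis using Hoeffdings_lemma_nn_integral[OF that(1)] by simp
  qed
  consider "l > 0" | "l = 0" | "l < 0" by linarith
  then show ?thesis
  proof cases
    case 1
    then show ?thesis using *[of l q 0 1] q by simp
  next
    case 2
    then show ?thesis by (simp add: emeasure_space_1)
  next
    case 3
    then show ?thesis using *[of "-l" "\<lambda>x. - q x" "-1" 0] q by (simp add: algebra_simps)
  qed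
qed

text \<open>Independence factorizes the exponential into \<open>n\<close> moments with parameter
  \<open>l / n\<close>, and n (l/n)^2 / 8 = l^2 / (8n).\<close>

lemma nn_integral_exp_emp_mean:
  fixes q :: "'x \<Rightarrow> real"
  assumes "prob_space D" "n > 0" and [measurable]: "q \<in> borel_measurable D"
    and q: "\<And>x. 0 \<le> q x" "\<And>x. q x \<le> 1"
  shows "(\<integral>\<^sup>+xs. ennreal (exp (l * (emp_mean n q xs - (\<integral>x. q x \<partial>D)))) \<partial>PiM {..<n} (\<lambda>_. D))
    \<le> ennreal (exp (l\<^sup>2 / (8 * real n)))"
proof -
  interpret D: prob_space D by fact
  interpret product_sigma_finite "\<lambda>_::nat. D" ..
  let ?\<mu> = "\<integral>x. q x \<partial>D"
  have eq: "exp (l * (emp_mean n q xs - ?\<mu>)) = (\<Prod>j<n. exp (l / real n * (q (xs j) - ?\<mu>)))" for xs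
  proof -
    have "(\<Sum>j<n. l / real n * (q (xs j) - ?\<mu>)) = l * (emp_mean n q xs - ?\<mu>)"
      unfolding sum_distrib_left[symmetric] sum_subtractf
      using assms(2) by (simp add: emp_mean_def field_simps)
    then show ?thesis by (simp add: exp_sum[symmetric])
  qed
  have "(\<integral>\<^sup>+xs. ennreal (exp (l * (emp_mean n q xs - ?\<mu>))) \<partial>PiM {..<n} (\<lambda>_. D))
     = (\<Prod>j<n. \<integral>\<^sup>+x. ennreal (exp (l / real n * (q x - ?\<mu>))) \<partial>D)"
    unfolding eq by (subst product_nn_integral_prod[symmetric]) (auto simp: prod_ennreal)
  also have "\<dots> \<le> (\<Prod>j<n. ennreal (exp ((l / real n)\<^sup>2 / 8)))"
    by (intro prod_mono_ennreal D.nn_integral_exp_centered_unit_interval q) auto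
  also have "\<dots> = ennreal (exp (l\<^sup>2 / (8 * real n)))"
    using assms(2) by (simp add: ennreal_power exp_of_nat_mult[symmetric] power_divide power2_eq_square)
  finally show ?thesis .
qed

lemma nn_integral_exp_square_emp_mean:
  fixes q :: "'x \<Rightarrow> real"
  assumes "prob_space D" "n > 0" and [measurable]: "q \<in> borel_measurable D"
    and q: "\<And>x. 0 \<le> q x" "\<And>x. q x \<le> 1" and t: "0 < t" "t < 1"
  shows "(\<integral>\<^sup>+xs. ennreal (exp (2 * real n * t * (emp_mean n q xs - (\<integral>x. q x \<partial>D))\<^sup>2)) \<partial>PiM {..<n} (\<lambda>_. D))
    \<le> ennreal (1 / sqrt (1 - t))"
proof -
  interpret D: prob_space D by fact
  interpret P: product_prob_space "\<lambda>_. D" "{..<n}" ..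
  interpret PL: pair_sigma_finite "PiM {..<n} (\<lambda>_. D)" "lborel :: real measure" ..
  have [measurable]: "emp_mean n q \<in> borel_measurable (PiM {..<n} (\<lambda>_. D))"
    unfolding emp_mean_def[abs_def] by measurable
  define \<Delta> where "\<Delta> xs = emp_mean n q xs - (\<integral>x. q x \<partial>D)" for xs
  have [measurable]: "\<Delta> \<in> borel_measurable (PiM {..<n} (\<lambda>_. D))" unfolding \<Delta>_def by measurable
  \<comment> \<open>This makes \<open>s\<^sup>2 / 2 = 2 * real n * t\<close>, as the linearization
    requires; the subgaussian bound then gives
    \<open>(s * y)\<^sup>2 / (8 * real n) = t * y\<^sup>2 / 2\<close>, which a standard Gaussian
    integrates for \<open>t < 1\<close>.\<close>
  define s where "s = sqrt (4 * real n * t)"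
  have s2: "s\<^sup>2 = 4 * real n * t" using t by (simp add: s_def)
  \<comment> \<open>exp of a square is a Gaussian average of exponentials of linear functions\<close>
  have "(\<integral>\<^sup>+xs. ennreal (exp (2 * real n * t * (\<Delta> xs)\<^sup>2)) \<partial>PiM {..<n} (\<lambda>_. D))
     = (\<integral>\<^sup>+xs. \<integral>\<^sup>+y. ennreal (std_normal_density y * exp (s * \<Delta> xs * y)) \<partial>lborel \<partial>PiM {..<n} (\<lambda>_. D))"
    unfolding nn_integral_std_normal_exp by (simp add: power_mult_distrib s2 mult_ac)
  also have "\<dots> = (\<integral>\<^sup>+y. \<integral>\<^sup>+xs. ennreal (std_normal_density y * exp (s * \<Delta> xs * y)) \<partial>PiM {..<n} (\<lambda>_. D) \<partial>lborel)"
    by (rule PL.Fubini'[symmetric]) measurable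
  also have "\<dots> = (\<integral>\<^sup>+y. ennreal (std_normal_density y) * (\<integral>\<^sup>+xs. ennreal (exp (s * y * \<Delta> xs)) \<partial>PiM {..<n} (\<lambda>_. D)) \<partial>lborel)"
    by (simp add: ennreal_mult nn_integral_cmult mult_ac)
  also have "\<dots> \<le> (\<integral>\<^sup>+y. ennreal (std_normal_density y) * ennreal (exp ((s * y)\<^sup>2 / (8 * real n))) \<partial>lborel)"
    unfolding \<Delta>_def by (intro nn_integral_mono mult_left_mono nn_integral_exp_emp_mean assms) auto
  also have "\<dots> = (\<integral>\<^sup>+y. ennreal (std_normal_density y * exp (t * y\<^sup>2 / 2)) \<partial>lborel)"
    using assms(2) by (simp add: ennreal_mult[symmetric] power_mult_distrib s2)
  also have "\<dots> = ennreal (1 / sqrt (1 - t))" by (rule nn_integral_std_normal_exp_square[OF t(2)])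
  finally show ?thesis unfolding \<Delta>_def .
qed

section \<open>The most inaccurate query\<close>

text \<open>
  No measurability of f is required, because the integral of an arbitrary function is a supremum
  over measurable minorants. This spares joint measurability of the transcript in the seed.
\<close>
lemma nn_integral_pair_le_iterated:
  fixes f :: "'a \<times> 'b \<times> 'c \<Rightarrow> ennreal"
  assumes "sigma_finite_measure A" "sigma_finite_measure B" "sigma_finite_measure C"
  shows "(\<integral>\<^sup>+w. f w \<partial>(A \<Otimes>\<^sub>M B \<Otimes>\<^sub>M C)) \<le> (\<integral>\<^sup>+c. \<integral>\<^sup>+a. \<integral>\<^sup>+b. f (a, b, c) \<partial>B \<partial>A \<partial>C)"
  unfolding nn_integral_def[of "A \<Otimes>\<^sub>M B \<Otimes>\<^sub>M C"]
proof (rule SUP_least, clarsimp)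
  interpret A: sigma_finite_measure A by fact
  interpret B: sigma_finite_measure B by fact
  interpret C: sigma_finite_measure C by fact
  interpret BC: pair_sigma_finite B C ..
  interpret AC: pair_sigma_finite A C ..
  interpret ABC: pair_sigma_finite A "B \<Otimes>\<^sub>M C" ..
  fix g assume g: "simple_function (A \<Otimes>\<^sub>M B \<Otimes>\<^sub>M C) g" and le: "g \<le> f"
  have [measurable]: "g \<in> borel_measurable (A \<Otimes>\<^sub>M B \<Otimes>\<^sub>M C)"
    using g by (rule borel_measurable_simple_function)
  have "integral\<^sup>S (A \<Otimes>\<^sub>M B \<Otimes>\<^sub>M C) g = (\<integral>\<^sup>+w. g w \<partial>(A \<Otimes>\<^sub>M B \<Otimes>\<^sub>M C))"
    using g by (rule nn_integral_eq_simple_integral[symmetric])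
  also have "\<dots> = (\<integral>\<^sup>+a. \<integral>\<^sup>+v. g (a, v) \<partial>(B \<Otimes>\<^sub>M C) \<partial>A)"
    by (rule BC.P.nn_integral_fst[symmetric]) measurable
  also have "\<dots> = (\<integral>\<^sup>+a. \<integral>\<^sup>+c. \<integral>\<^sup>+b. g (a, b, c) \<partial>B \<partial>C \<partial>A)"
    by (intro nn_integral_cong BC.nn_integral_snd[symmetric]) measurable
  also have "\<dots> = (\<integral>\<^sup>+c. \<integral>\<^sup>+a. \<integral>\<^sup>+b. g (a, b, c) \<partial>B \<partial>A \<partial>C)"
    by (rule AC.Fubini'[symmetric]) measurable
  also have "\<dots> \<le> (\<integral>\<^sup>+c. \<integral>\<^sup>+a. \<integral>\<^sup>+b. f (a, b, c) \<partial>B \<partial>A \<partial>C)"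
    using le by (intro nn_integral_mono) (auto simp: le_fun_def)
  finally show "integral\<^sup>S (A \<Otimes>\<^sub>M B \<Otimes>\<^sub>M C) g \<le> (\<integral>\<^sup>+c. \<integral>\<^sup>+a. \<integral>\<^sup>+b. f (a, b, c) \<partial>B \<partial>A \<partial>C)" .
qed

text \<open>Answers are never revised, so the final transcript determines all earlier histories and
  hence, for a fixed seed, all queries.\<close>

lemma hist_eq_restrict: "i \<le> k \<Longrightarrow> hist n Q r xs z i = restrict (hist n Q r xs z k) {..<i}"
proof (induction k)
  case 0
  then show ?case by (auto simp: restrict_def)
next
  case (Suc k)
  have ext: "hist n Q r xs z j \<in> extensional {..<j}" for j
    by (induction j) (auto simp: extensional_def)
  show ?case
  proof (cases "i = Suc k")
    case True
    show ?thesis unfolding True[symmetric] by (rule extensional_restrict[OF ext, symmetric])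
  next
    case False
    then have "i \<le> k" using Suc.prems by simp
    then show ?thesis using Suc.IH by (auto simp: restrict_def)
  qed
qed

lemma hist_nth: "i < k \<Longrightarrow> hist n Q r xs z k i = emp_mean n (Q i (hist n Q r xs z i) r) xs + z i"
  by (induction k) (auto simp: less_Suc_eq)

lemma emp_mean_bounds:
  assumes "n > 0" "\<And>x. 0 \<le> q x" "\<And>x. q x \<le> 1"
  shows "0 \<le> emp_mean n q xs" "emp_mean n q xs \<le> 1"
proof -
  show "0 \<le> emp_mean n q xs" using assms by (simp add: emp_mean_def sum_nonneg)
  have "(\<Sum>j<n. q (xs j)) \<le> (\<Sum>j<n. 1)" using assms by (intro sum_mono) auto
  then show "emp_mean n q xs \<le> 1" using assms(1) by (simp add: emp_mean_def)
qed

lemma emp_mean_upd_diff: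
  assumes "j < n" "\<And>x. 0 \<le> q x" "\<And>x. q x \<le> 1"
  shows "\<bar>emp_mean n q xs - emp_mean n q (xs(j := x))\<bar> \<le> 1 / real n"
proof -
  have "(\<Sum>i<n. q (xs i)) - (\<Sum>i<n. q ((xs(j := x)) i)) = q (xs j) - q x"
    using assms(1) by (simp add: sum.remove[of "{..<n}" j])
  then have "emp_mean n q xs - emp_mean n q (xs(j := x)) = (q (xs j) - q x) / real n"
    by (simp add: emp_mean_def diff_divide_distrib[symmetric])
  moreover have "\<bar>q (xs j) - q x\<bar> \<le> 1"
    using assms(2,3)[of "xs j"] assms(2,3)[of x] by linarith
  ultimately show ?thesis by (simp add: abs_divide divide_right_mono)
qed

text \<open>A non-integrable function has integral 0, so the bounds hold without measurability. This
  gives \<open>gap_bounds\<close> for all arguments, as the tensorized bound demands.\<close>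

lemma (in prob_space) integral_unit_interval_bounds:
  fixes q :: "'a \<Rightarrow> real"
  assumes "\<And>x. 0 \<le> q x" "\<And>x. q x \<le> 1"
  shows "0 \<le> expectation q" "expectation q \<le> 1"
proof -
  show "0 \<le> expectation q" using assms by simp
  show "expectation q \<le> 1"
    using integral_le_const[of q 1] assms not_integrable_integral_eq[of M q] by (cases "integrable M q") auto
qed

text \<open>The seed \<open>r\<close> is fixed, which makes the analyst deterministic and leaves
  measurability only in the history and the data point. The average over seeds is taken at the very
  end.\<close>

locale adaptive_queries = D: prob_space D for D :: "'x measure" +
  fixes Q :: "nat \<Rightarrow> (nat \<Rightarrow> real) \<Rightarrow> 'r \<Rightarrow> 'x \<Rightarrow> real" and r :: 'r and n k :: nat and \<rho> \<sigma> :: real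
  assumes n: "n > 0" and k: "k \<ge> 1" and \<rho>: "\<rho> > 0"
    and Q0: "\<And>i h x. 0 \<le> Q i h r x" and Q1: "\<And>i h x. Q i h r x \<le> 1"
    and Q_meas: "\<And>i. (\<lambda>(h, x). Q i h r x) \<in> borel_measurable (PiM {..<i} (\<lambda>_. borel) \<Otimes>\<^sub>M D)"
    and \<sigma>: "\<sigma> = sqrt (1 / (2 * real n ^ 2 * \<rho>))"
begin

abbreviation "Dn \<equiv> PiM {..<n} (\<lambda>_. D)"
abbreviation "Lk \<equiv> PiM {..<k} (\<lambda>_. lborel :: real measure)"
abbreviation "Ak \<equiv> PiM {..<k} (\<lambda>_. borel :: real measure)"
abbreviation "m xs i h \<equiv> emp_mean n (Q i h r) xs"
abbreviation "\<mu> i h \<equiv> \<integral>x. Q i h r x \<partial>D"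
abbreviation "p xs a \<equiv> transcript_density \<sigma> (m xs) k a"

definition "err i a = (\<mu> i (restrict a {..<i}) - a i)\<^sup>2"
text \<open>A maximizer of \<open>err\<close>, with ties broken by \<open>LEAST\<close> so that the
  choice is a measurable function of the transcript.\<close>

definition "worst a = (LEAST i. i \<in> {..<k} \<and> (\<forall>j\<in>{..<k}. err j a \<le> err i a))"
\<comment> \<open>the value 0 for i \<ge> k makes gap measurable for every i, so that it can be composed with worst\<close>
definition "gap i xs a = (if i < k then (m xs i (restrict a {..<i}) - \<mu> i (restrict a {..<i}))\<^sup>2 else 0)"

lemma \<sigma>_pos: "\<sigma> > 0" using n \<rho> by (simp add: \<sigma>)

lemma worst: "worst a < k" "j < k \<Longrightarrow> err j a \<le> err (worst a) a"
proof -
  have "\<exists>i. i \<in> {..<k} \<and> (\<forall>j\<in>{..<k}. err j a \<le> err i a)"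
  proof -
    have ne: "finite ((\<lambda>j. err j a) ` {..<k})" "(\<lambda>j. err j a) ` {..<k} \<noteq> {}" using k by (auto simp: lessThan_empty_iff)
    obtain i where "i < k" "Max ((\<lambda>j. err j a) ` {..<k}) = err i a" using Max_in[OF ne] by auto
    then show ?thesis using Max_ge[OF ne(1)] by (intro exI[of _ i]) auto
  qed
  from LeastI_ex[OF this] show "worst a < k" "j < k \<Longrightarrow> err j a \<le> err (worst a) a"
    unfolding worst_def by auto
qed

section \<open>Measurability of the selection and of the selected error\<close>

lemma measurable_restrict_history [measurable]:
  "i \<le> k \<Longrightarrow> (\<lambda>a. restrict a {..<i}) \<in> Ak \<rightarrow>\<^sub>M PiM {..<i} (\<lambda>_. borel)"
  by (intro measurable_restrict_subset) auto

lemma measurable_population_mean [measurable]: "(\<lambda>h. \<mu> i h) \<in> borel_measurable (PiM {..<i} (\<lambda>_. borel))"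
  by (rule D.borel_measurable_lebesgue_integral[OF Q_meas])

lemma measurable_sample_mean [measurable]:
  "(\<lambda>w. m (fst w) i (snd w)) \<in> borel_measurable (Dn \<Otimes>\<^sub>M PiM {..<i} (\<lambda>_. borel))"
proof -
  have [measurable]: "(\<lambda>w. Q i (snd w) r (fst w j)) \<in> borel_measurable (Dn \<Otimes>\<^sub>M PiM {..<i} (\<lambda>_. borel))" if "j < n" for j
    using measurable_compose[OF _ Q_meas[of i], of "\<lambda>w. (snd w, fst w j)" "Dn \<Otimes>\<^sub>M PiM {..<i} (\<lambda>_. borel)"] that
    by simp
  show ?thesis unfolding emp_mean_def by measurable
qed

lemma measurable_sample_mean_fixed:
  assumes "xs \<in> space Dn"
  shows "(\<lambda>h. m xs i h) \<in> borel_measurable (PiM {..<i} (\<lambda>_. borel))"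
  using measurable_Pair2[OF measurable_sample_mean assms] by simp

lemma measurable_err: "i < k \<Longrightarrow> err i \<in> borel_measurable Ak"
  unfolding err_def[abs_def] by measurable

lemma measurable_worst [measurable]: "worst \<in> Ak \<rightarrow>\<^sub>M count_space UNIV"
  unfolding worst_def[abs_def]
proof (rule measurable_Least)
  fix i
  show "Measurable.pred Ak (\<lambda>a. i \<in> {..<k} \<and> (\<forall>j\<in>{..<k}. err j a \<le> err i a))"
  proof (cases "i < k")
    case True
    have [measurable]: "Measurable.pred Ak (\<lambda>a. err j a \<le> err i a)" if "j \<in> {..<k}" for j
    proof -
      have [measurable]: "err i \<in> borel_measurable Ak" "err j \<in> borel_measurable Ak"
        using True that by (auto intro: measurable_err)
      show ?thesis unfolding pred_def by (rule borel_measurable_le) fact+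
    qed
    show ?thesis by measurable
  qed simp
qed

lemma measurable_gap [measurable]: "(\<lambda>w. gap i (fst w) (snd w)) \<in> borel_measurable (Dn \<Otimes>\<^sub>M Ak)"
proof (cases "i < k")
  case True
  have [measurable]: "(\<lambda>w. m (fst w) i (restrict (snd w) {..<i})) \<in> borel_measurable (Dn \<Otimes>\<^sub>M Ak)"
    using measurable_compose[OF _ measurable_sample_mean[of i], of "\<lambda>w. (fst w, restrict (snd w) {..<i})" "Dn \<Otimes>\<^sub>M Ak"] True
    by simp
  have [measurable]: "(\<lambda>w. \<mu> i (restrict (snd w) {..<i})) \<in> borel_measurable (Dn \<Otimes>\<^sub>M Ak)"
    using True by (intro measurable_compose[OF _ measurable_population_mean]) simp
  show ?thesis unfolding gap_def if_P[OF True] by measurable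
qed (simp add: gap_def)

lemma measurable_worst_gap [measurable]: "(\<lambda>w. gap (worst (snd w)) (fst w) (snd w)) \<in> borel_measurable (Dn \<Otimes>\<^sub>M Ak)"
  by (rule measurable_compose_countable[OF measurable_gap]) measurable

lemma measurable_density [measurable]: "(\<lambda>w. p (fst w) (snd w)) \<in> borel_measurable (Dn \<Otimes>\<^sub>M Ak)"
proof -
  have [measurable]: "(\<lambda>w. m (fst w) i (restrict (snd w) {..<i})) \<in> borel_measurable (Dn \<Otimes>\<^sub>M Ak)" if "i < k" for i
    using measurable_compose[OF _ measurable_sample_mean[of i], of "\<lambda>w. (fst w, restrict (snd w) {..<i})" "Dn \<Otimes>\<^sub>M Ak"] that
    by simp
  show ?thesis unfolding transcript_density_def by measurable
qed

lemma gap_bounds: "0 \<le> gap i xs a" "gap i xs a \<le> 1"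
proof -
  show "0 \<le> gap i xs a" by (simp add: gap_def)
  let ?h = "restrict a {..<i}"
  have "0 \<le> m xs i ?h" "m xs i ?h \<le> 1" "0 \<le> \<mu> i ?h" "\<mu> i ?h \<le> 1"
    by (intro emp_mean_bounds D.integral_unit_interval_bounds n Q0 Q1)+
  then have "\<bar>m xs i ?h - \<mu> i ?h\<bar> \<le> 1" by linarith
  then show "gap i xs a \<le> 1" by (simp add: gap_def abs_square_le_1)
qed

text \<open>The tensorized bound with \<open>2 * real n * t * gap\<close> as test function, entropy
  \<open>k * \<rho>\<close> per sample point and exponential moment \<open>1 / sqrt (1 - t)\<close>,
  divided by \<open>2 * real n * t\<close>.\<close>

lemma worst_gap_bound:
  assumes t: "0 < t" "t < 1"
  shows "(\<integral>\<^sup>+xs. \<integral>\<^sup>+a. ennreal (p xs a) * ennreal (gap (worst a) xs a) \<partial>Lk \<partial>Dn)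
     \<le> ennreal ((2 * \<rho> * real k * real n - ln (1 - t)) / t / (4 * real n))"
proof -
  define f where "f xs a = 2 * real n * t * gap (worst a) xs a" for xs a
  interpret L: finite_product_sigma_finite "\<lambda>_. lborel :: real measure" "{..<k}" by standard simp
  have c: "2 * real n * t > 0" using n t by simp
  have "(\<integral>\<^sup>+xs. \<integral>\<^sup>+a. ennreal (p xs a * f xs a) \<partial>Lk \<partial>Dn)
     \<le> of_nat n * ennreal (real k * ((1 / real n)\<^sup>2 / (2 * \<sigma>\<^sup>2))) + ennreal (ln (1 / sqrt (1 - t)))"
  proof (rule tensorized_gibbs_variational_bound[OF D.prob_space_axioms L.sigma_finite_measure_axioms, where B="2 * real n * t"])
    show "(\<lambda>(xs, a). p xs a) \<in> borel_measurable (Dn \<Otimes>\<^sub>M Lk)"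
      "(\<lambda>(xs, a). f xs a) \<in> borel_measurable (Dn \<Otimes>\<^sub>M Lk)"
      unfolding f_def case_prod_beta' by measurable
    show "0 < p xs a" for xs a by (rule transcript_density_pos[OF \<sigma>_pos])
    show "(\<integral>\<^sup>+a. p xs a \<partial>Lk) = 1" if "xs \<in> space Dn" for xs
      by (rule nn_integral_transcript_density[OF \<sigma>_pos measurable_sample_mean_fixed[OF that]])
    show "(\<integral>\<^sup>+a. klint (p xs a) (p (xs(j := x)) a) \<partial>Lk) \<le> ennreal (real k * ((1 / real n)\<^sup>2 / (2 * \<sigma>\<^sup>2)))"
      if "xs \<in> space Dn" "j < n" "x \<in> space D" for xs j x
    proof -
      have "xs(j := x) \<in> space Dn" using that by (auto simp: space_PiM PiE_def extensional_def)
      then show ?thesis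
        by (intro nn_integral_klint_transcript_density \<sigma>_pos measurable_sample_mean_fixed
            emp_mean_upd_diff that Q0 Q1)
    qed
    show "0 \<le> f xs a" "f xs a \<le> 2 * real n * t" for xs a
      using gap_bounds[of "worst a" xs a] c by (auto simp: f_def mult_left_le)
    show "0 < 1 / sqrt (1 - t)" using t by simp
    show "(\<integral>\<^sup>+xs. ennreal (exp (f xs a)) \<partial>Dn) \<le> ennreal (1 / sqrt (1 - t))" if "a \<in> space Lk" for a
    proof -
      \<comment> \<open>With \<open>a\<close> frozen, \<open>worst a\<close> names one query that
        does not depend on \<open>xs\<close>, so the bound for a single fixed query applies
        regardless of \<open>k\<close>.\<close>
      let ?i = "worst a" and ?h = "restrict a {..<worst a}"
      have "?h \<in> space (PiM {..<?i} (\<lambda>_. borel :: real measure))" by (simp add: space_PiM)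
      from measurable_Pair2[OF Q_meas this] have "Q ?i ?h r \<in> borel_measurable D" by simp
      from nn_integral_exp_square_emp_mean[OF D.prob_space_axioms n this Q0 Q1 t]
      show ?thesis using worst(1)[of a] by (simp add: f_def gap_def)
    qed
  qed
  \<comment> \<open>The noise variance is calibrated to sensitivity \<open>1 / n\<close>: each round
    then costs exactly \<open>\<rho>\<close>.\<close>
  also have "(1 / real n)\<^sup>2 / (2 * \<sigma>\<^sup>2) = \<rho>"
    using n \<rho> by (simp add: \<sigma> power_divide field_simps)
  also have "of_nat n * ennreal (real k * \<rho>) + ennreal (ln (1 / sqrt (1 - t))) = ennreal (real n * (real k * \<rho>) - ln (1 - t) / 2)"
  proof -
    have "ln (1 / sqrt (1 - t)) = - ln (1 - t) / 2" using t by (simp add: ln_div ln_sqrt)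
    moreover have "ln (1 - t) \<le> 0" using t by simp
    ultimately show ?thesis using \<rho>
      by (simp add: ennreal_of_nat_eq_real_of_nat ennreal_mult[symmetric] ennreal_plus[symmetric] del: ennreal_plus)
  qed
  finally have *: "(\<integral>\<^sup>+xs. \<integral>\<^sup>+a. ennreal (p xs a * f xs a) \<partial>Lk \<partial>Dn)
     \<le> ennreal (real n * (real k * \<rho>) - ln (1 - t) / 2)" .
  have "(\<integral>\<^sup>+xs. \<integral>\<^sup>+a. ennreal (p xs a) * ennreal (gap (worst a) xs a) \<partial>Lk \<partial>Dn)
      = (\<integral>\<^sup>+xs. \<integral>\<^sup>+a. ennreal (1 / (2 * real n * t)) * ennreal (p xs a * f xs a) \<partial>Lk \<partial>Dn)"
  proof (intro nn_integral_cong)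
    fix xs a
    have "p xs a * gap (worst a) xs a = 1 / (2 * real n * t) * (p xs a * f xs a)"
      using n t by (simp add: f_def)
    then show "ennreal (p xs a) * ennreal (gap (worst a) xs a) = ennreal (1 / (2 * real n * t)) * ennreal (p xs a * f xs a)"
      using c gap_bounds(1) by (simp only: ennreal_mult'[symmetric] ennreal_mult''[symmetric] less_imp_le zero_le_divide_1_iff)
  qed
  also have "\<dots> = ennreal (1 / (2 * real n * t)) * (\<integral>\<^sup>+xs. \<integral>\<^sup>+a. ennreal (p xs a * f xs a) \<partial>Lk \<partial>Dn)"
  proof (subst nn_integral_cmult[symmetric])
    show "(\<lambda>xs. \<integral>\<^sup>+a. ennreal (p xs a * f xs a) \<partial>Lk) \<in> borel_measurable Dn"
      unfolding f_def by measurable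
  next
    have joint: "(\<lambda>w. p (fst w) (snd w) * f (fst w) (snd w)) \<in> borel_measurable (Dn \<Otimes>\<^sub>M Lk)"
      unfolding f_def by measurable
    have "(\<lambda>a. p xs a * f xs a) \<in> borel_measurable Lk" if "xs \<in> space Dn" for xs
      using measurable_Pair2[OF joint that] by simp
    then show "(\<integral>\<^sup>+xs. \<integral>\<^sup>+a. ennreal (1 / (2 * real n * t)) * ennreal (p xs a * f xs a) \<partial>Lk \<partial>Dn)
      = (\<integral>\<^sup>+xs. ennreal (1 / (2 * real n * t)) * (\<integral>\<^sup>+a. ennreal (p xs a * f xs a) \<partial>Lk) \<partial>Dn)"
      by (intro nn_integral_cong nn_integral_cmult) simp
  qed
  also have "\<dots> \<le> ennreal (1 / (2 * real n * t)) * ennreal (real n * (real k * \<rho>) - ln (1 - t) / 2)"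
    by (intro mult_left_mono *) simp
  also have "\<dots> = ennreal ((2 * \<rho> * real k * real n - ln (1 - t)) / t / (4 * real n))"
    using c by (subst ennreal_mult'[symmetric]) (auto simp: field_simps)
  finally show ?thesis .
qed

section \<open>Expected maximal error for a fixed seed\<close>

abbreviation "Nk \<equiv> PiM {..<k} (\<lambda>_. density lborel (normal_density 0 \<sigma>))"

lemma sets_Nk [measurable_cong]: "sets Nk = sets Ak"
  by (intro sets_PiM_cong) auto

lemma max_error_le:
  "ennreal (Max ((\<lambda>i. ((\<integral>x. query n Q r xs z i x \<partial>D) - answer n Q r xs z i)\<^sup>2) ` {..<k}))
    \<le> 2 * ennreal (gap (worst (hist n Q r xs z k)) xs (hist n Q r xs z k)) + 2 * ennreal (Max ((\<lambda>i. (z i)\<^sup>2) ` {..<k}))"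
proof -
  define a where "a = hist n Q r xs z k"
  have ne: "{..<k} \<noteq> {}" using k by (auto simp: lessThan_empty_iff)
  have e: "((\<integral>x. query n Q r xs z i x \<partial>D) - answer n Q r xs z i)\<^sup>2 = err i a" if "i < k" for i
    using hist_eq_restrict[of i k n Q r xs z] hist_nth[of i k n Q r xs z] that
    by (simp add: err_def a_def query_def answer_def)
  let ?s = "worst a"
  have s: "?s < k" by (rule worst)
  have as: "a ?s = m xs ?s (restrict a {..<?s}) + z ?s"
    using hist_eq_restrict[of ?s k n Q r xs z] hist_nth[of ?s k n Q r xs z] s by (simp add: a_def)
  \<comment> \<open>The right side exceeds the left by exactly
    \<open>(x - y + w)\<^sup>2\<close>.\<close>
  have sq: "(x - (y + w))\<^sup>2 \<le> 2 * (y - x)\<^sup>2 + 2 * w\<^sup>2" for x y w :: real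
    using zero_le_power2[of "x - y + w"] by (simp add: power2_eq_square algebra_simps)
  have "Max ((\<lambda>i. ((\<integral>x. query n Q r xs z i x \<partial>D) - answer n Q r xs z i)\<^sup>2) ` {..<k}) \<le> err ?s a"
    using ne by (intro Max.boundedI) (auto simp: e worst(2))
  also have "\<dots> \<le> 2 * gap ?s xs a + 2 * (z ?s)\<^sup>2"
    using s unfolding err_def gap_def as by (simp add: sq)
  \<comment> \<open>The selected round depends on the noise, so \<open>z ?s\<close> need not be
    Gaussian; it is controlled only through the maximum, which is why the maximal noise appears in
    the bound.\<close>
  also have "(z ?s)\<^sup>2 \<le> Max ((\<lambda>i. (z i)\<^sup>2) ` {..<k})" using s by (intro Max_ge) auto
  finally have le: "Max ((\<lambda>i. ((\<integral>x. query n Q r xs z i x \<partial>D) - answer n Q r xs z i)\<^sup>2) ` {..<k})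
    \<le> 2 * gap ?s xs a + 2 * Max ((\<lambda>i. (z i)\<^sup>2) ` {..<k})" by simp
  have "0 \<le> Max ((\<lambda>i. (z i)\<^sup>2) ` {..<k})" using s by (intro order_trans[OF zero_le_power2[of "z ?s"] Max_ge]) auto
  then have "2 * ennreal (gap ?s xs a) + 2 * ennreal (Max ((\<lambda>i. (z i)\<^sup>2) ` {..<k}))
     = ennreal (2 * gap ?s xs a + 2 * Max ((\<lambda>i. (z i)\<^sup>2) ` {..<k}))"
    using gap_bounds(1)[of ?s xs a] by (simp add: ennreal_mult)
  then show ?thesis using ennreal_leI[OF le] by (simp add: a_def)
qed

lemma expected_max_error_le:
  assumes t: "0 < t" "t < 1"
  shows "(\<integral>\<^sup>+xs. \<integral>\<^sup>+z. ennreal (Max ((\<lambda>i. ((\<integral>x. query n Q r xs z i x \<partial>D) - answer n Q r xs z i)\<^sup>2) ` {..<k})) \<partial>Nk \<partial>Dn)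
    \<le> ennreal ((2 * \<rho> * real k * real n - ln (1 - t)) / t / (2 * real n))
       + 2 * (\<integral>\<^sup>+z. ennreal (Max ((\<lambda>i. (z i)\<^sup>2) ` {..<k})) \<partial>Nk)"
proof -
  let ?E = "\<integral>\<^sup>+z. ennreal (Max ((\<lambda>i. (z i)\<^sup>2) ` {..<k})) \<partial>Nk"
  have ne: "{..<k} \<noteq> {}" using k by (auto simp: lessThan_empty_iff)
  have [measurable]: "(\<lambda>z. Max ((\<lambda>i. (z i)\<^sup>2) ` {..<k})) \<in> borel_measurable Ak"
    using ne by (intro borel_measurable_Max) auto
  interpret P: product_prob_space "\<lambda>_. D" "{..<n}" ..
  interpret L: finite_product_sigma_finite "\<lambda>_. lborel :: real measure" "{..<k}" by standard simp
  have inner: "(\<integral>\<^sup>+z. ennreal (Max ((\<lambda>i. ((\<integral>x. query n Q r xs z i x \<partial>D) - answer n Q r xs z i)\<^sup>2) ` {..<k})) \<partial>Nk)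
     \<le> 2 * (\<integral>\<^sup>+a. ennreal (p xs a) * ennreal (gap (worst a) xs a) \<partial>Lk) + 2 * ?E" if xs: "xs \<in> space Dn" for xs
  proof -
    have [measurable]: "(\<lambda>a. gap (worst a) xs a) \<in> borel_measurable Ak"
      using measurable_Pair2[OF measurable_worst_gap xs] by simp
    have mh [measurable]: "(\<lambda>z. hist n Q r xs z k) \<in> Ak \<rightarrow>\<^sub>M Ak"
      by (intro measurable_hist measurable_sample_mean_fixed xs) auto
    have "(\<integral>\<^sup>+z. ennreal (Max ((\<lambda>i. ((\<integral>x. query n Q r xs z i x \<partial>D) - answer n Q r xs z i)\<^sup>2) ` {..<k})) \<partial>Nk)
       \<le> (\<integral>\<^sup>+z. 2 * ennreal (gap (worst (hist n Q r xs z k)) xs (hist n Q r xs z k))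
            + 2 * ennreal (Max ((\<lambda>i. (z i)\<^sup>2) ` {..<k})) \<partial>Nk)"
      by (intro nn_integral_mono max_error_le)
    also have "\<dots> = 2 * (\<integral>\<^sup>+z. ennreal (gap (worst (hist n Q r xs z k)) xs (hist n Q r xs z k)) \<partial>Nk) + 2 * ?E"
      by (simp add: nn_integral_add nn_integral_cmult)
    \<comment> \<open>Only the first term is rewritten as an integral over transcripts; the noise
      term does not involve the sample and stays an integral over \<open>z\<close>.\<close>
    also have "(\<integral>\<^sup>+z. ennreal (gap (worst (hist n Q r xs z k)) xs (hist n Q r xs z k)) \<partial>Nk)
       = (\<integral>\<^sup>+a. ennreal (p xs a) * ennreal (gap (worst a) xs a) \<partial>Lk)"
      by (rule nn_integral_hist[where n=n and Q=Q and r=r and xs=xs and k=k, OF \<sigma>_pos measurable_sample_mean_fixed[OF xs]]) measurable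
    finally show ?thesis .
  qed
  have "(\<integral>\<^sup>+xs. \<integral>\<^sup>+z. ennreal (Max ((\<lambda>i. ((\<integral>x. query n Q r xs z i x \<partial>D) - answer n Q r xs z i)\<^sup>2) ` {..<k})) \<partial>Nk \<partial>Dn)
     \<le> (\<integral>\<^sup>+xs. 2 * (\<integral>\<^sup>+a. ennreal (p xs a) * ennreal (gap (worst a) xs a) \<partial>Lk) + 2 * ?E \<partial>Dn)"
    by (intro nn_integral_mono inner)
  also have "\<dots> = 2 * (\<integral>\<^sup>+xs. \<integral>\<^sup>+a. ennreal (p xs a) * ennreal (gap (worst a) xs a) \<partial>Lk \<partial>Dn) + 2 * ?E"
    by (simp add: nn_integral_add nn_integral_cmult P.emeasure_space_1)
  also have "\<dots> \<le> 2 * ennreal ((2 * \<rho> * real k * real n - ln (1 - t)) / t / (4 * real n)) + 2 * ?E"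
    by (intro add_right_mono mult_left_mono worst_gap_bound t) auto
  also have "2 * ennreal ((2 * \<rho> * real k * real n - ln (1 - t)) / t / (4 * real n))
     = ennreal ((2 * \<rho> * real k * real n - ln (1 - t)) / t / (2 * real n))"
  proof -
    have "2 * ennreal (x / (4 * real n)) = ennreal (2 * (x / (4 * real n)))" for x
      by (simp only: ennreal_mult' zero_le_numeral ennreal_numeral)
    also have "2 * (x / (4 * real n)) = x / (2 * real n)" for x by simp
    finally show ?thesis .
  qed
  finally show ?thesis .
qed

end

section \<open>Averaging over the seed and optimizing over \<open>t\<close>\<close>

theorem mainTheorem5:
  fixes D :: "'x measure" and R :: "'r measure"
    and Q :: "nat \<Rightarrow> (nat \<Rightarrow> real) \<Rightarrow> 'r \<Rightarrow> 'x \<Rightarrow> real"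
    and n k :: nat and \<rho> :: real
  assumes "prob_space D" and "prob_space R"
    and "n > 0" and "k \<ge> 1" and "\<rho> > 0"
    and Q_range: "\<And>i h r x. 0 \<le> Q i h r x \<and> Q i h r x \<le> 1"
    and Q_meas: "\<And>i. (\<lambda>(h, r, x). Q i h r x)
        \<in> borel_measurable (PiM {..<i} (\<lambda>_. borel) \<Otimes>\<^sub>M R \<Otimes>\<^sub>M D)"
  defines "\<sigma> \<equiv> sqrt (1 / (2 * real n ^ 2 * \<rho>))"
  defines "N \<equiv> PiM {..<k} (\<lambda>_. density lborel (normal_density 0 \<sigma>))"
  shows "(\<integral>\<^sup>+ (xs, z, r). ennreal (Max ((\<lambda>i.
              ((\<integral>x. query n Q r xs z i x \<partial>D) - answer n Q r xs z i)\<^sup>2) ` {..<k}))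
          \<partial>(PiM {..<n} (\<lambda>_. D) \<Otimes>\<^sub>M N \<Otimes>\<^sub>M R))
    \<le> ennreal (1 / (2 * real n) *
          (INF t\<in>{0<..<1::real}. (2 * \<rho> * real k * real n - ln (1 - t)) / t))
       + 2 * (\<integral>\<^sup>+ z. ennreal (Max ((\<lambda>i. (z i)\<^sup>2) ` {..<k})) \<partial>N)"
proof -
  interpret D: prob_space D by fact
  interpret R: prob_space R by fact
  interpret P: product_prob_space "\<lambda>_. D" "{..<n}" ..
  have \<sigma>_pos: "\<sigma> > 0" using assms(3,5) by (simp add: \<sigma>_def)
  interpret G: prob_space "density lborel (normal_density 0 \<sigma>)" by (rule prob_space_normal_density[OF \<sigma>_pos])
  interpret N: product_prob_space "\<lambda>_. density lborel (normal_density 0 \<sigma>)" "{..<k}" ..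
  let ?F = "\<lambda>(xs, z, r). ennreal (Max ((\<lambda>i. ((\<integral>x. query n Q r xs z i x \<partial>D) - answer n Q r xs z i)\<^sup>2) ` {..<k}))"
  let ?E = "\<integral>\<^sup>+ z. ennreal (Max ((\<lambda>i. (z i)\<^sup>2) ` {..<k})) \<partial>N"
  let ?b = "\<lambda>t. (2 * \<rho> * real k * real n - ln (1 - t)) / t"
  let ?I = "INF t\<in>{0<..<1}. ?b t"
  have Q_meas_seed: "(\<lambda>(h, x). Q i h r x) \<in> borel_measurable (PiM {..<i} (\<lambda>_. borel) \<Otimes>\<^sub>M D)"
    if r: "r \<in> space R" for i r
  proof -
    have "(\<lambda>w. (fst w, r, snd w)) \<in> PiM {..<i} (\<lambda>_. borel :: real measure) \<Otimes>\<^sub>M D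
        \<rightarrow>\<^sub>M PiM {..<i} (\<lambda>_. borel) \<Otimes>\<^sub>M R \<Otimes>\<^sub>M D"
      using r by measurable
    from measurable_compose[OF this Q_meas] show ?thesis by (simp add: case_prod_beta')
  qed
  have bound: "(\<integral>\<^sup>+w. ?F w \<partial>(PiM {..<n} (\<lambda>_. D) \<Otimes>\<^sub>M N \<Otimes>\<^sub>M R)) \<le> ennreal (?b t / (2 * real n)) + 2 * ?E"
    if t: "0 < t" "t < 1" for t
  proof -
    \<comment> \<open>With the seed outermost, each inner integral concerns a deterministic analyst,
      and the resulting bound is uniform in \<open>r\<close>.\<close>
    have "(\<integral>\<^sup>+w. ?F w \<partial>(PiM {..<n} (\<lambda>_. D) \<Otimes>\<^sub>M N \<Otimes>\<^sub>M R))
       \<le> (\<integral>\<^sup>+r. \<integral>\<^sup>+xs. \<integral>\<^sup>+z. ?F (xs, z, r) \<partial>N \<partial>PiM {..<n} (\<lambda>_. D) \<partial>R)"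
      unfolding N_def by (rule nn_integral_pair_le_iterated) standard
    also have "\<dots> \<le> (\<integral>\<^sup>+r. ennreal (?b t / (2 * real n)) + 2 * ?E \<partial>R)"
    proof (rule nn_integral_mono)
      fix r assume "r \<in> space R"
      then interpret adaptive_queries D Q r n k \<rho> \<sigma>
        using assms(3-5) Q_range Q_meas_seed by unfold_locales (auto simp: \<sigma>_def)
      show "(\<integral>\<^sup>+xs. \<integral>\<^sup>+z. ?F (xs, z, r) \<partial>N \<partial>PiM {..<n} (\<lambda>_. D)) \<le> ennreal (?b t / (2 * real n)) + 2 * ?E"
        using expected_max_error_le[OF t] unfolding N_def by simp
    qed
    also have "\<dots> = ennreal (?b t / (2 * real n)) + 2 * ?E" by (simp add: R.emeasure_space_1)
    finally show ?thesis .
  qed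
  have b0: "0 \<le> ?b t" if "0 < t" "t < 1" for t
  proof -
    have "ln (1 - t) \<le> 0" using that by simp
    moreover have "0 \<le> 2 * \<rho> * real k * real n" using assms(5) by simp
    ultimately show ?thesis using that(1) by (intro divide_nonneg_pos) linarith+
  qed
  \<comment> \<open>Nonnegativity of the infimum is what later allows \<open>ennreal\<close> to be
    split over the sum with \<open>e\<close>.\<close>
  have I0: "0 \<le> ?I" by (rule cINF_greatest) (auto simp: b0)
  have "(\<integral>\<^sup>+w. ?F w \<partial>(PiM {..<n} (\<lambda>_. D) \<Otimes>\<^sub>M N \<Otimes>\<^sub>M R)) \<le> ennreal (1 / (2 * real n) * ?I) + 2 * ?E"
  proof (rule ennreal_le_epsilon)
    fix e :: real assume e: "0 < e"
    \<comment> \<open>No minimizer is computed: a near-optimal \<open>t\<close> suffices. The slack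
      \<open>2 * real n * e\<close> becomes \<open>e\<close> after division by
      \<open>2 * real n\<close>.\<close>
    have "\<exists>t\<in>{0<..<1}. ?b t < ?I + 2 * real n * e"
    proof (rule ccontr)
      assume "\<not> ?thesis"
      then have "?I + 2 * real n * e \<le> ?I" by (intro cINF_greatest) (auto simp: not_less)
      moreover have "0 < 2 * real n * e" using e assms(3) by simp
      ultimately show False by linarith
    qed
    then obtain t where t: "0 < t" "t < 1" "?b t < ?I + 2 * real n * e" by auto
    have "x / (2 * real n) \<le> 1 / (2 * real n) * y + e" if "x < y + 2 * real n * e" for x y
      using that assms(3) by (simp add: field_simps)
    from this[OF t(3)]
    have "?b t / (2 * real n) \<le> 1 / (2 * real n) * ?I + e" .
    from ennreal_leI[OF this]
    have "ennreal (?b t / (2 * real n)) \<le> ennreal (1 / (2 * real n) * ?I + e)" .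
    also have "\<dots> = ennreal (1 / (2 * real n) * ?I) + ennreal e"
      by (intro ennreal_plus mult_nonneg_nonneg I0 less_imp_le[OF e]) simp
    finally have "ennreal (?b t / (2 * real n)) + 2 * ?E \<le> ennreal (1 / (2 * real n) * ?I) + ennreal e + 2 * ?E"
      by (rule add_right_mono)
    also have "\<dots> = ennreal (1 / (2 * real n) * ?I) + 2 * ?E + ennreal e"
      by (simp only: ac_simps)
    finally show "(\<integral>\<^sup>+w. ?F w \<partial>(PiM {..<n} (\<lambda>_. D) \<Otimes>\<^sub>M N \<Otimes>\<^sub>M R))
       \<le> ennreal (1 / (2 * real n) * ?I) + 2 * ?E + ennreal e"
      by (rule order_trans[OF bound[OF t(1,2)]])
  qed
  then show ?thesis .
qed

end
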